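(* Fix $d\ge2$ and let $\mathcal{H}$ be an arbitrary set of hyperplanes in $\mathbb{R}^d$. Then every set of $n$ points in $\mathbb{R}^d$ with at most $\ell$ points on any hyperplane in $\mathcal{H}$, where $2\le\ell=O(n^{1/2})$, contains a subset of $\Omega\left((n/\log\ell)^{1/d}\right)$ points such that every hyperplane in $\mathcal{H}$ contains at most $d$ of these points.
   Context: The constant in $\Omega(\cdot)$ depends only on $d$ and on the constant in the hypothesis $\ell=O(n^{1/2})$, not on $n$, $\mathcal{H}$ or the point set. *)

theory Defs
  imports "HOL-Analysis.Analysis"
begin

definition hyperplane :: "'a::euclidean_space set \<Rightarrow> bool" where
  "hyperplane h \<longleftrightarrow> (\<exists>a b. a \<noteq> 0 \<and> h = {x. a \<bullet> x = b})"

lemma hyperplane_iff_aff_dim: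
  fixes h :: "'a::euclidean_space set"
  shows "hyperplane h \<longleftrightarrow> affine h \<and> aff_dim h = int (DIM('a)) - 1"
proof
  assume "hyperplane h"
  then show "affine h \<and> aff_dim h = int (DIM('a)) - 1"
    unfolding hyperplane_def by (auto simp: affine_hyperplane)
next
  assume A: "affine h \<and> aff_dim h = int (DIM('a)) - 1"
  then obtain a b where "a \<noteq> 0" "affine hull h = {x. a \<bullet> x = b}"
    using aff_dim_eq_hyperplane[of h] by auto
  moreover have "affine hull h = h"
    using A by (simp add: affine_hull_eq)
  ultimately have "a \<noteq> 0 \<and> h = {x. a \<bullet> x = b}"
    by simp
  then show "hyperplane h"
    unfolding hyperplane_def by blast
qed

end

theory Submission
  imports Defs
begin

text \<open>
  Lift a point \<open>x\<close> to the vector \<open>(1, x)\<close>, so that flats become linear subspaces and points pairwise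
  independent vectors. The Szemeredi--Trotter theorem bounds the number of planes through the origin
  containing at least \<open>k\<close> of \<open>n\<close> such vectors by a multiple of \<open>n\<^sup>2 / k\<^sup>3 + n / k\<close>. Following Elekes and
  Toth, projecting from a point extends this to \<open>s\<close>-dimensional subspaces \<open>G\<close> that are nondegenerate, i.e.
  no proper subspace contains more than a small proportion of the points of \<open>G\<close>: at most
  \<open>K (n\<^sup>s / k\<^bsup>s+1\<^esup> + n\<^bsup>s-1\<^esup> / k\<^bsup>s-1\<^esup>)\<close> of them contain \<open>k\<close> points. Every subspace spanned by \<open>d + 1\<close>
  points of a hyperplane contains a nondegenerate subspace with a constant proportion of its points,
  and summing over these shows that \<open>O(n\<^sup>d ln l)\<close> of the \<open>(d+1)\<close>-sets lie on a hyperplane of the family.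
  A random sample of the right density, with one point deleted from each surviving such set, is
  the required subset.
\<close>

section \<open>Straight-line plane graphs\<close>

text \<open>Nondegeneracy is forced: all hyperplanes through one rich flat of lower dimension are
  rich, so no bound of Szemeredi--Trotter type holds for arbitrary rich flats. The exponents fit the
  final count. A nondegenerate subspace of dimension s with a points accounts for about n^(d-s)
  a^(s+1) dependent sets; weighting the bound for richness a by a^s and summing over a \<le> l gives
  n^s times the sum of 1/a, which is the source of the logarithm, plus n^(s-1) times the sum of a.
  The latter is at most n^(s-1) l^2, and l = O(n^(1/2)) turns it into O(n^s). With T = O(n^d ln l)
  bad sets, the sampling density p balances p n against p^(d+1) T, so that p^d is of order
  1/(n^(d-1) ln l) and p n of order (n/ln l)^(1/d). The planar theorem comes from the crossing
  lemma. Its topological input, a linear bound on the edges of a plane graph, is obtained from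
  vertical visibility instead of Euler's formula; the intermediate value theorem suffices, since
  edges are graphs of functions of the abscissa.\<close>

definition chord :: "(real \<Rightarrow> real) \<Rightarrow> real \<times> real \<Rightarrow> real \<Rightarrow> real" where
  "chord Y e t = Y (fst e) + (Y (snd e) - Y (fst e)) / (snd e - fst e) * (t - fst e)"

definition slope :: "(real \<Rightarrow> real) \<Rightarrow> real \<times> real \<Rightarrow> real" where
  "slope Y e = (Y (snd e) - Y (fst e)) / (snd e - fst e)"

text \<open>Meeting at an endpoint is not a crossing, whereas two collinear edges that overlap do
  cross: \<open>t\<close> has only to be interior to both spans.\<close>

definition crosses :: "(real \<Rightarrow> real) \<Rightarrow> real \<times> real \<Rightarrow> real \<times> real \<Rightarrow> bool" where
  "crosses Y e e' \<longleftrightarrow> e \<noteq> e' \<and>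
     (\<exists>t. fst e < t \<and> t < snd e \<and> fst e' < t \<and> t < snd e' \<and> chord Y e t = chord Y e' t)"

lemma chord_fst: "chord Y (u, v) u = Y u"
  by (simp add: chord_def)

lemma chord_snd: "u < v \<Longrightarrow> chord Y (u, v) v = Y v"
  by (simp add: chord_def)

lemma chord_slope: "chord Y e t = Y (fst e) + slope Y e * (t - fst e)"
  by (simp add: chord_def slope_def)

lemma chord_slope_snd:
  assumes "fst e < snd e"
  shows "chord Y e t = Y (snd e) - slope Y e * (snd e - t)"
proof -
  have "slope Y e * (snd e - fst e) = Y (snd e) - Y (fst e)"
    using assms by (simp add: slope_def)
  then show ?thesis unfolding chord_slope by (simp add: algebra_simps)
qed

lemma continuous_on_chord: "continuous_on S (chord Y e)"
  unfolding chord_def[abs_def] by (intro continuous_intros)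

text \<open>Intermediate value theorem for the difference of the chords. The conclusion is not
  strict because the edges may share the endpoint at \<open>t\<close>.\<close>

lemma not_crosses_order:
  assumes "\<not> crosses Y e e'" "e \<noteq> e'" "fst e \<le> s" "fst e' \<le> s" "t \<le> snd e" "t \<le> snd e'" "s < t"
    and "chord Y e s < chord Y e' s"
  shows "chord Y e t \<le> chord Y e' t"
proof (rule ccontr)
  let ?D = "\<lambda>x. chord Y e x - chord Y e' x"
  assume "\<not> ?thesis"
  then have "?D s \<le> 0" "0 \<le> ?D t" using assms by auto
  moreover have "continuous_on {s..t} ?D"
    by (intro continuous_intros continuous_on_chord)
  ultimately obtain x where x: "s \<le> x" "x \<le> t" "?D x = 0"
    using IVT'[of ?D s 0 t] assms(7) by auto
  with assms(8) \<open>\<not> ?thesis\<close> have "x \<noteq> s" "x \<noteq> t" by auto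
  with x assms show False unfolding crosses_def by force
qed

text \<open>A vertex is identified with its abscissa and \<open>Y\<close> gives its height, so no
  two vertices lie on a common vertical. \<open>no_vertex\<close> is a separate condition because
  \<open>crosses\<close> ignores an edge that ends on another one.\<close>

locale plane_graph =
  fixes X :: "real set" and Y :: "real \<Rightarrow> real" and E :: "(real \<times> real) set"
  assumes finite_X: "finite X"
    and E_sub: "\<And>u v. (u, v) \<in> E \<Longrightarrow> u \<in> X \<and> v \<in> X \<and> u < v"
    and no_vertex: "\<And>u v t. (u, v) \<in> E \<Longrightarrow> t \<in> X \<Longrightarrow> u < t \<Longrightarrow> t < v \<Longrightarrow> chord Y (u, v) t \<noteq> Y t"
    and no_cross: "\<And>e e'. e \<in> E \<Longrightarrow> e' \<in> E \<Longrightarrow> \<not> crosses Y e e'"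
begin

lemma finite_E: "finite E"
  by (rule finite_subset[of E "X \<times> X"]) (auto dest: E_sub simp: finite_X)

lemma order_kept:
  assumes "(u, v) \<in> E" "(u', v') \<in> E" "u \<le> s" "u' \<le> s" "t \<le> v" "t \<le> v'" "s < t"
    and "chord Y (u, v) s < chord Y (u', v') s"
  shows "chord Y (u, v) t \<le> chord Y (u', v') t"
  using not_crosses_order[of Y "(u, v)" "(u', v')" s t] no_cross assms by auto

text \<open>The vertical ray going down from \<open>w\<close> meets \<open>e\<close> first.\<close>

definition sees :: "real \<Rightarrow> real \<times> real \<Rightarrow> bool" where
  "sees w e \<longleftrightarrow> fst e < w \<and> w < snd e \<and> chord Y e w < Y w \<and>
     (\<forall>e'\<in>E. fst e' < w \<longrightarrow> w < snd e' \<longrightarrow> \<not> (chord Y e w < chord Y e' w \<and> chord Y e' w < Y w))"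

definition top_right :: "real \<Rightarrow> real \<times> real \<Rightarrow> bool" where
  "top_right u e \<longleftrightarrow> fst e = u \<and> (\<forall>e'\<in>E. fst e' = u \<longrightarrow> slope Y e' \<le> slope Y e)"

text \<open>To the left of \<open>v\<close> a smaller slope lies higher, hence the inequality
  opposite to that of \<open>top_right\<close>.\<close>

definition top_left :: "real \<Rightarrow> real \<times> real \<Rightarrow> bool" where
  "top_left v e \<longleftrightarrow> snd e = v \<and> (\<forall>e'\<in>E. snd e' = v \<longrightarrow> slope Y e \<le> slope Y e')"

lemma sees_unique: "e \<in> E \<Longrightarrow> e' \<in> E \<Longrightarrow> sees w e \<Longrightarrow> sees w e' \<Longrightarrow> e = e'"
  using no_cross[of e e'] unfolding sees_def crosses_def
  by (metis linorder_neqE_linordered_idom)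

text \<open>Edges with the same start and the same slope overlap, which counts as a
  crossing.\<close>

lemma slope_fst_unique:
  assumes "e \<in> E" "e' \<in> E" "fst e = fst e'" "slope Y e = slope Y e'"
  shows "e = e'"
proof (rule ccontr)
  assume ne: "e \<noteq> e'"
  obtain u v v' where e: "e = (u, v)" "e' = (u, v')" using assms(3) by (cases e; cases e') auto
  obtain t where "u < t" "t < min v v'" using dense[of u "min v v'"] E_sub assms(1,2) e by auto
  then have "crosses Y e e'" unfolding crosses_def using ne assms(3,4) e
    by (auto simp: chord_slope intro!: exI[of _ t])
  with no_cross assms show False by blast
qed

lemma slope_snd_unique:
  assumes "e \<in> E" "e' \<in> E" "snd e = snd e'" "slope Y e = slope Y e'"
  shows "e = e'"
proof (rule ccontr)
  assume ne: "e \<noteq> e'"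
  obtain u v u' where e: "e = (u, v)" "e' = (u', v)" using assms(3) by (cases e; cases e') auto
  have uv: "u < v" "u' < v" using E_sub assms(1,2) e by auto
  obtain t where "t < v" "max u u' < t" using dense[of "max u u'" v] uv by auto
  then have "crosses Y e e'" unfolding crosses_def using ne assms(3,4) e uv
    by (auto simp: chord_slope_snd intro!: exI[of _ t])
  with no_cross assms show False by blast
qed

text \<open>
  With \<open>f\<close> the next edge above \<open>(u, v)\<close> at \<open>u\<close>, the leftmost vertex in the region between \<open>(u, v)\<close> and \<open>f\<close>
  sees \<open>(u, v)\<close>: an edge blocking the view would have to start in that region. The region contains
  a vertex because \<open>f\<close> cannot cross an edge that reaches \<open>v\<close> from above.
\<close>

lemma edge_charged:
  assumes e: "(u, v) \<in> E" and nr: "\<not> top_right u (u, v)" and nl: "\<not> top_left v (u, v)"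
  shows "\<exists>w\<in>X. sees w (u, v)"
proof -
  note uv = E_sub[OF e]
  define F where "F = {f \<in> E. fst f = u \<and> slope Y (u, v) < slope Y f}"
  have "F \<noteq> {}" "finite F" using nr finite_E by (auto simp: F_def top_right_def not_le)
  then obtain f where f: "f \<in> F" "\<And>f'. f' \<in> F \<Longrightarrow> slope Y f \<le> slope Y f'"
    using arg_min_if_finite[of F "slope Y"] by (metis not_less)
  obtain a where fa: "f = (u, a)" using f(1) by (cases f) (auto simp: F_def)
  have faE: "(u, a) \<in> E" and sl_f: "slope Y (u, v) < slope Y (u, a)" using f(1) fa by (auto simp: F_def)
  note ua = E_sub[OF faE]
  obtain b where gE: "(b, v) \<in> E" and sl_g: "slope Y (b, v) < slope Y (u, v)"
    using nl by (auto simp: top_left_def not_le)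
  note bv = E_sub[OF gE]
  have f_above: "chord Y (u, v) t < chord Y (u, a) t" if "u < t" for t
    using sl_f that by (simp add: chord_slope)
  have g_above: "chord Y (u, v) t < chord Y (b, v) t" if "t < v" for t
    using sl_g that uv bv by (simp add: chord_slope_snd)
  define R where "R = {w \<in> X. u < w \<and> w < v \<and> w \<le> a \<and> chord Y (u, v) w < Y w \<and> Y w \<le> chord Y (u, a) w}"
  have "R \<noteq> {}"
  proof (cases "a < v")
    case True
    then have "a \<in> R" using ua f_above[of a] by (auto simp: R_def chord_snd)
    then show ?thesis by auto
  next
    case False
    \<comment> \<open>Otherwise \<open>(u, a)\<close> runs below \<open>(b, v)\<close> at
      \<open>u\<close> and has to stay weakly below it up to \<open>v\<close>; but at
      \<open>v\<close> it passes strictly above the vertex where \<open>(b, v)\<close> ends.\<close>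
    have "u < b"
    proof (rule ccontr)
      assume "\<not> u < b"
      have "chord Y (u, a) u < chord Y (b, v) u"
        using g_above[of u] uv by (simp add: chord_fst)
      then have "chord Y (u, a) v \<le> chord Y (b, v) v"
        using order_kept[OF faE gE, of u v] False \<open>\<not> u < b\<close> uv by auto
      then show False using f_above[of v] uv bv by (simp add: chord_snd)
    qed
    moreover have "Y b \<le> chord Y (u, a) b"
    proof (rule ccontr)
      assume "\<not> ?thesis"
      then have "chord Y (u, a) b < chord Y (b, v) b" by (simp add: chord_fst)
      then have "chord Y (u, a) v \<le> chord Y (b, v) v"
        using order_kept[OF faE gE, of b v] False \<open>u < b\<close> bv by auto
      then show False using f_above[of v] uv bv by (simp add: chord_snd)
    qed
    ultimately have "b \<in> R" using g_above[of b] bv False by (auto simp: R_def chord_fst)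
    then show ?thesis by auto
  qed
  have "finite R" using finite_X by (auto simp: R_def)
  define w where "w = Min R"
  have wR: "w \<in> R" and wmin: "\<And>x. x \<in> R \<Longrightarrow> w \<le> x"
    using \<open>finite R\<close> \<open>R \<noteq> {}\<close> by (auto simp: w_def)
  have w: "w \<in> X" "u < w" "w < v" "w \<le> a" "chord Y (u, v) w < Y w" "Y w \<le> chord Y (u, a) w"
    using wR by (auto simp: R_def)
  \<comment> \<open>A blocking edge starting right of \<open>u\<close> has its left end in
    \<open>R\<close>, against the minimality of \<open>w\<close>. One starting at \<open>u\<close>
    has a slope between those of \<open>(u, v)\<close> and \<open>f\<close>, against the choice of
    \<open>f\<close>. One starting left of \<open>u\<close> passes above or below the vertex
    \<open>u\<close> and is then kept outside the region.\<close>
  have "False" if E': "(u', v') \<in> E" and u': "u' < w" "w < v'"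
    and bt: "chord Y (u, v) w < chord Y (u', v') w" "chord Y (u', v') w < Y w" for u' v'
  proof -
    consider "u < u'" | "u' = u" | "u' < u" by linarith
    then show False
    proof cases
      case 1
      note ue = E_sub[OF E']
      have "chord Y (u, v) u' < Y u'"
      proof (rule ccontr)
        assume "\<not> ?thesis"
        moreover have "chord Y (u, v) u' \<noteq> Y u'" using no_vertex[OF e, of u'] 1 u' w ue by auto
        ultimately have "chord Y (u', v') u' < chord Y (u, v) u'" by (simp add: chord_fst)
        then have "chord Y (u', v') w \<le> chord Y (u, v) w"
          using order_kept[OF E' e, of u' w] 1 u' w by auto
        then show False using bt by simp
      qed
      moreover have "Y u' \<le> chord Y (u, a) u'"
      proof (rule ccontr)
        assume "\<not> ?thesis"
        then have "chord Y (u, a) u' < chord Y (u', v') u'" by (simp add: chord_fst)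
        then have "chord Y (u, a) w \<le> chord Y (u', v') w"
          using order_kept[OF faE E', of u' w] 1 u' w by auto
        then show False using bt w by simp
      qed
      ultimately have "u' \<in> R" using 1 u' w ue by (auto simp: R_def)
      then show False using wmin[of u'] u' by simp
    next
      case 2
      have "chord Y (u, v) w < chord Y (u, v') w" "chord Y (u, v') w < chord Y (u, a) w"
        using bt w(6) 2 by auto
      then have "slope Y (u, v) * (w - u) < slope Y (u', v') * (w - u)"
        "slope Y (u', v') * (w - u) < slope Y (u, a) * (w - u)"
        using 2 unfolding chord_slope by simp_all
      then have "slope Y (u, v) < slope Y (u', v')" "slope Y (u', v') < slope Y (u, a)"
        using w by auto
      then show False using f(2)[of "(u', v')"] 2 E' fa by (auto simp: F_def)
    next
      case 3
      have "chord Y (u', v') u \<noteq> Y u" using no_vertex[OF E', of u] 3 u' w uv by auto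
      then consider "chord Y (u', v') u < chord Y (u, v) u" | "chord Y (u, a) u < chord Y (u', v') u"
        by (force simp: chord_fst)
      then show False
      proof cases
        case 1
        then have "chord Y (u', v') w \<le> chord Y (u, v) w"
          using order_kept[OF E' e, of u w] 3 u' w by auto
        then show False using bt by simp
      next
        case 2
        then have "chord Y (u, a) w \<le> chord Y (u', v') w"
          using order_kept[OF faE E', of u w] 3 u' w by auto
        then show False using bt w by simp
      qed
    qed
  qed
  then have "sees w (u, v)" using w unfolding sees_def by force
  then show ?thesis using w by blast
qed

text \<open>Every edge is charged to a vertex in one of three roles: topmost edge leaving it to the
  right, topmost edge arriving from the left, or first edge seen below it. A vertex receives at most
  one edge in each role.\<close>

lemma card_edges_le: "card E \<le> 3 * card X"
proof -
  have inj: "card {e \<in> E. \<exists>w\<in>X. Q w e} \<le> card X"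
    if "\<And>w e e'. e \<in> E \<Longrightarrow> e' \<in> E \<Longrightarrow> Q w e \<Longrightarrow> Q w e' \<Longrightarrow> e = e'" for Q :: "real \<Rightarrow> real \<times> real \<Rightarrow> bool"
  proof -
    have "{e \<in> E. \<exists>w\<in>X. Q w e} \<subseteq> (\<lambda>w. THE e. e \<in> E \<and> Q w e) ` X"
    proof
      fix e assume "e \<in> {e \<in> E. \<exists>w\<in>X. Q w e}"
      then obtain w where w: "w \<in> X" "e \<in> E" "Q w e" by auto
      have "(THE e. e \<in> E \<and> Q w e) = e"
      proof (rule the_equality)
        show "e \<in> E \<and> Q w e" using w by simp
        fix e' assume "e' \<in> E \<and> Q w e'"
        then show "e' = e" using that[of e' e w] w by simp
      qed
      then show "e \<in> (\<lambda>w. THE e. e \<in> E \<and> Q w e) ` X" using imageI[OF w(1), of "\<lambda>w. THE e. e \<in> E \<and> Q w e"] by simp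
    qed
    then show ?thesis using finite_X by (meson card_image_le card_mono finite_imageI le_trans)
  qed
  have "E \<subseteq> {e \<in> E. \<exists>w\<in>X. sees w e} \<union> {e \<in> E. \<exists>w\<in>X. top_right w e} \<union> {e \<in> E. \<exists>w\<in>X. top_left w e}"
  proof
    fix e assume "e \<in> E"
    obtain u v where e: "e = (u, v)" by (cases e)
    with \<open>e \<in> E\<close> have "u \<in> X" "v \<in> X" using E_sub by auto
    with edge_charged[of u v] \<open>e \<in> E\<close> e
    show "e \<in> {e \<in> E. \<exists>w\<in>X. sees w e} \<union> {e \<in> E. \<exists>w\<in>X. top_right w e} \<union> {e \<in> E. \<exists>w\<in>X. top_left w e}"
      by auto
  qed
  then have "card E \<le> card ({e \<in> E. \<exists>w\<in>X. sees w e} \<union> {e \<in> E. \<exists>w\<in>X. top_right w e} \<union> {e \<in> E. \<exists>w\<in>X. top_left w e})"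
    using finite_E by (intro card_mono) auto
  also have "\<dots> \<le> card {e \<in> E. \<exists>w\<in>X. sees w e} + card {e \<in> E. \<exists>w\<in>X. top_right w e} + card {e \<in> E. \<exists>w\<in>X. top_left w e}"
    by (meson add_mono card_Un_le le_refl le_trans)
  also have "\<dots> \<le> card X + card X + card X"
  proof (intro add_mono inj)
    fix w e e' assume *: "e \<in> E" "e' \<in> E"
    show "sees w e \<Longrightarrow> sees w e' \<Longrightarrow> e = e'" using sees_unique * by blast
    show "top_right w e \<Longrightarrow> top_right w e' \<Longrightarrow> e = e'"
      using slope_fst_unique[OF *] * unfolding top_right_def by (metis order_antisym)
    show "top_left w e \<Longrightarrow> top_left w e' \<Longrightarrow> e = e'"
      using slope_snd_unique[OF *] * unfolding top_left_def by (metis order_antisym)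
  qed
  finally show ?thesis by simp
qed

end

section \<open>The crossing lemma and the Szemeredi--Trotter theorem\<close>

definition subset_weight :: "real \<Rightarrow> 'a set \<Rightarrow> 'a set \<Rightarrow> real" where
  "subset_weight p X A = p ^ card A * (1 - p) ^ card (X - A)"

lemma subset_weight_nonneg: "0 \<le> p \<Longrightarrow> p \<le> 1 \<Longrightarrow> 0 \<le> subset_weight p X A"
  by (simp add: subset_weight_def)

text \<open>Expand the product of \<open>p + (1 - p)\<close> over \<open>X\<close>, with the second
  summand replaced by 0 on \<open>B\<close>: the terms whose set \<open>A\<close> misses a point of
  \<open>B\<close> vanish.\<close>

lemma sum_subset_weight_superset:
  assumes "finite X" "B \<subseteq> X"
  shows "(\<Sum>A\<in>Pow X. if B \<subseteq> A then subset_weight p X A else 0) = p ^ card B"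
proof -
  let ?g = "\<lambda>x. if x \<in> B then 0 else 1 - p"
  have "p ^ card B = (\<Prod>x\<in>X. if x \<in> B then p else 1)"
    using assms by (simp add: prod.If_cases Int_absorb1)
  also have "\<dots> = (\<Prod>x\<in>X. p + ?g x)" by (intro prod.cong) auto
  also have "\<dots> = (\<Sum>A\<in>Pow X. (\<Prod>x\<in>A. p) * (\<Prod>x\<in>X - A. ?g x))"
    by (rule prod_add) fact
  also have "\<dots> = (\<Sum>A\<in>Pow X. if B \<subseteq> A then subset_weight p X A else 0)"
  proof (intro sum.cong refl)
    fix A assume "A \<in> Pow X"
    show "(\<Prod>x\<in>A. p) * (\<Prod>x\<in>X - A. ?g x) = (if B \<subseteq> A then subset_weight p X A else 0)"
    proof (cases "B \<subseteq> A")
      case True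
      then have "(\<Prod>x\<in>X - A. ?g x) = (\<Prod>x\<in>X - A. 1 - p)" by (intro prod.cong) auto
      then show ?thesis using True by (simp add: subset_weight_def)
    next
      case False
      then have "\<exists>x\<in>X - A. ?g x = 0" using assms by auto
      then show ?thesis using False assms by (simp add: prod_zero)
    qed
  qed
  finally show ?thesis by simp
qed

lemma sum_subset_weight:
  assumes "finite X"
  shows "(\<Sum>A\<in>Pow X. subset_weight p X A) = 1"
  using sum_subset_weight_superset[OF assms, of "{}" p] by simp

text \<open>Linearity of expectation: after swapping the sums, each \<open>i\<close> contributes the
  probability that \<open>B i\<close> survives.\<close>

lemma expected_card:
  assumes "finite X" "finite I" "\<And>i. i \<in> I \<Longrightarrow> B i \<subseteq> X"
  shows "(\<Sum>A\<in>Pow X. subset_weight p X A * real (card {i \<in> I. B i \<subseteq> A})) = (\<Sum>i\<in>I. p ^ card (B i))"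
proof -
  have "(\<Sum>A\<in>Pow X. subset_weight p X A * real (card {i \<in> I. B i \<subseteq> A}))
      = (\<Sum>A\<in>Pow X. \<Sum>i\<in>I. if B i \<subseteq> A then subset_weight p X A else 0)"
    using assms(2) by (simp add: sum.If_cases Int_def mult.commute)
  also have "\<dots> = (\<Sum>i\<in>I. \<Sum>A\<in>Pow X. if B i \<subseteq> A then subset_weight p X A else 0)"
    by (rule sum.swap)
  also have "\<dots> = (\<Sum>i\<in>I. p ^ card (B i))"
    using assms by (intro sum.cong refl sum_subset_weight_superset) auto
  finally show ?thesis .
qed

lemma expected_card_self:
  assumes "finite X"
  shows "(\<Sum>A\<in>Pow X. subset_weight p X A * real (card A)) = p * real (card X)"
proof -
  have "(\<Sum>A\<in>Pow X. subset_weight p X A * real (card A))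
      = (\<Sum>A\<in>Pow X. subset_weight p X A * real (card {x \<in> X. {x} \<subseteq> A}))"
    by (intro sum.cong refl arg_cong2[of _ _ _ _ "(*)"] arg_cong[of _ _ real] arg_cong[of _ _ card]) auto
  also have "\<dots> = p * real (card X)"
    using expected_card[OF assms assms, of "\<lambda>x. {x}" p] by (simp add: mult.commute)
  finally show ?thesis .
qed

text \<open>In the graph induced on a random vertex set, deleting every edge that crosses another
  leaves a plane graph. An edge survives sampling with probability \<open>p ^ 2\<close>, and a
  crossing with probability \<open>p ^ 4\<close>, because \<open>ends\<close> makes its four
  endpoints distinct. \<open>N\<close> consists of ordered pairs, so a crossing is counted twice;
  \<open>p\<close> stays free for the later optimisation.\<close>

lemma crossing_lemma:
  fixes p :: real
  assumes X: "finite X"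
    and E_sub: "\<And>u v. (u, v) \<in> E \<Longrightarrow> u \<in> X \<and> v \<in> X \<and> u < v"
    and no_vertex: "\<And>u v t. (u, v) \<in> E \<Longrightarrow> t \<in> X \<Longrightarrow> u < t \<Longrightarrow> t < v \<Longrightarrow> chord Y (u, v) t \<noteq> Y t"
    and ends: "\<And>u v u' v'. (u, v) \<in> E \<Longrightarrow> (u', v') \<in> E \<Longrightarrow> crosses Y (u, v) (u', v') \<Longrightarrow> {u, v} \<inter> {u', v'} = {}"
    and p: "0 \<le> p" "p \<le> 1"
  defines "N \<equiv> {(e, e'). e \<in> E \<and> e' \<in> E \<and> crosses Y e e'}"
  shows "p ^ 2 * real (card E) \<le> 3 * p * real (card X) + p ^ 4 * real (card N)"
proof -
  define B where "B = (\<lambda>e::real \<times> real. {fst e, snd e})"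
  have E: "finite E" by (rule finite_subset[of E "X \<times> X"]) (auto dest: E_sub simp: X)
  have N: "finite N" by (rule finite_subset[of N "E \<times> E"]) (auto simp: N_def E)
  have BX: "B e \<subseteq> X" if "e \<in> E" for e using E_sub[of "fst e" "snd e"] that by (auto simp: B_def)
  have B2: "card (B e) = 2" if "e \<in> E" for e using E_sub[of "fst e" "snd e"] that by (auto simp: B_def)
  have B4: "card (B (fst c) \<union> B (snd c)) = 4" if "c \<in> N" for c
  proof -
    obtain u v u' v' where c: "c = ((u, v), (u', v'))" by (metis surj_pair)
    have "{u, v} \<inter> {u', v'} = {}" "(u, v) \<in> E" "(u', v') \<in> E"
      using that ends[of u v u' v'] by (auto simp: N_def c)
    then have "card ({u, v} \<union> {u', v'}) = 2 + 2"
      using E_sub[of u v] E_sub[of u' v'] by (subst card_Un_disjoint) auto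
    then show ?thesis by (simp add: B_def c insert_commute)
  qed
  have local_bound: "real (card {e \<in> E. B e \<subseteq> A}) \<le> 3 * real (card A) + real (card {c \<in> N. B (fst c) \<union> B (snd c) \<subseteq> A})"
    if A: "A \<in> Pow X" for A
  proof -
    let ?E = "{e \<in> E. B e \<subseteq> A}" and ?N = "{c \<in> N. B (fst c) \<union> B (snd c) \<subseteq> A}"
    have "plane_graph A Y (?E - fst ` ?N)"
    proof
      show "finite A" using A X finite_subset by auto
      show "u \<in> A \<and> v \<in> A \<and> u < v" if "(u, v) \<in> ?E - fst ` ?N" for u v
        using that E_sub[of u v] by (auto simp: B_def)
      show "chord Y (u, v) t \<noteq> Y t" if "(u, v) \<in> ?E - fst ` ?N" "t \<in> A" "u < t" "t < v" for u v t
        using that no_vertex[of u v t] A by auto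
      show "\<not> crosses Y e e'" if "e \<in> ?E - fst ` ?N" "e' \<in> ?E - fst ` ?N" for e e'
      proof
        assume "crosses Y e e'"
        then have "(e, e') \<in> ?N" using that by (auto simp: N_def)
        then have "e \<in> fst ` ?N" by force
        then show False using that by simp
      qed
    qed
    then have "card (?E - fst ` ?N) \<le> 3 * card A" by (rule plane_graph.card_edges_le)
    moreover have "card ?E \<le> card (?E - fst ` ?N) + card (fst ` ?N)"
    proof -
      have "card ?E \<le> card ((?E - fst ` ?N) \<union> fst ` ?N)"
        using E N by (intro card_mono) auto
      also have "\<dots> \<le> card (?E - fst ` ?N) + card (fst ` ?N)" by (rule card_Un_le)
      finally show ?thesis .
    qed
    moreover have "card (fst ` ?N) \<le> card ?N" using N by (intro card_image_le) auto
    ultimately show ?thesis by linarith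
  qed
  have "p ^ 2 * real (card E) = (\<Sum>e\<in>E. p ^ card (B e))" using B2 by simp
  also have "\<dots> = (\<Sum>A\<in>Pow X. subset_weight p X A * real (card {e \<in> E. B e \<subseteq> A}))"
    using expected_card[OF X E, of B p] BX by simp
  also have "\<dots> \<le> (\<Sum>A\<in>Pow X. subset_weight p X A *
      (3 * real (card A) + real (card {c \<in> N. B (fst c) \<union> B (snd c) \<subseteq> A})))"
    by (intro sum_mono mult_left_mono local_bound subset_weight_nonneg p)
  also have "\<dots> = 3 * (\<Sum>A\<in>Pow X. subset_weight p X A * real (card A))
      + (\<Sum>A\<in>Pow X. subset_weight p X A * real (card {c \<in> N. B (fst c) \<union> B (snd c) \<subseteq> A}))"
    by (simp add: sum.distrib sum_distrib_left algebra_simps)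
  also have "(\<Sum>A\<in>Pow X. subset_weight p X A * real (card {c \<in> N. B (fst c) \<union> B (snd c) \<subseteq> A}))
      = (\<Sum>c\<in>N. p ^ card (B (fst c) \<union> B (snd c)))"
  proof (rule expected_card[OF X N])
    fix c assume "c \<in> N"
    then show "B (fst c) \<union> B (snd c) \<subseteq> X" using BX by (fastforce simp: N_def)
  qed
  also have "\<dots> = p ^ 4 * real (card N)" using B4 by simp
  finally show ?thesis using expected_card_self[OF X, of p] by simp
qed

section \<open>The geometric graph joining neighbouring points on rich lines\<close>

definition consecutive :: "real set \<Rightarrow> (real \<times> real) set" where
  "consecutive S = {(u, v). u \<in> S \<and> v \<in> S \<and> u < v \<and> (\<forall>w\<in>S. \<not> (u < w \<and> w < v))}"

lemma finite_consecutive: "finite S \<Longrightarrow> finite (consecutive S)"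
  by (rule finite_subset[of _ "S \<times> S"]) (auto simp: consecutive_def)

text \<open>Every element except the maximum has a successor.\<close>

lemma card_consecutive_ge:
  assumes "finite S"
  shows "card S \<le> card (consecutive S) + 1"
proof (cases "S = {}")
  case False
  let ?f = "\<lambda>u. (u, Min {v \<in> S. u < v})"
  have "?f u \<in> consecutive S" if u: "u \<in> S - {Max S}" for u
  proof -
    have "Max S \<in> {v \<in> S. u < v}"
      using assms False u Max_ge[of S u] Max_in[of S] by (auto simp: order_less_le)
    then have ne: "finite {v \<in> S. u < v}" "{v \<in> S. u < v} \<noteq> {}" using assms by auto
    then have "Min {v \<in> S. u < v} \<in> {v \<in> S. u < v}" by (rule Min_in)
    moreover have "\<not> w < Min {v \<in> S. u < v}" if "w \<in> S" "u < w" for w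
      using Min_le[OF ne(1), of w] that by auto
    ultimately show ?thesis using u by (auto simp: consecutive_def)
  qed
  then have "card (S - {Max S}) \<le> card (consecutive S)"
    using finite_consecutive[OF assms] by (intro card_inj_on_le[of ?f]) (auto simp: inj_on_def)
  then show ?thesis using assms False by (simp add: card_Diff_singleton)
qed simp

lemma consecutive_unique:
  assumes "(u, v) \<in> consecutive S" "(u', v') \<in> consecutive S" "u < t" "t < v" "u' < t" "t < v'"
  shows "(u, v) = (u', v')"
proof -
  have "u = u'" using assms unfolding consecutive_def by (cases u u' rule: linorder_cases) force+
  moreover have "v = v'" using assms unfolding consecutive_def by (cases v v' rule: linorder_cases) force+
  ultimately show ?thesis by simp
qed

text \<open>A line is a pair of slope and intercept. Vertical lines are not represented; they would
  contain at most one point, since the points have distinct abscissae.\<close>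

definition on_line :: "real set \<Rightarrow> (real \<Rightarrow> real) \<Rightarrow> real \<times> real \<Rightarrow> real set" where
  "on_line X Y l = {x \<in> X. Y x = fst l * x + snd l}"

lemma on_line_unique:
  assumes "u \<in> on_line X Y l" "v \<in> on_line X Y l" "u \<in> on_line X Y l'" "v \<in> on_line X Y l'" "u \<noteq> v"
  shows "l = l'"
proof -
  have *: "fst l * u + snd l = fst l' * u + snd l'" "fst l * v + snd l = fst l' * v + snd l'"
    using assms by (auto simp: on_line_def)
  then have "(fst l - fst l') * (u - v) = 0" by (simp add: algebra_simps)
  then have "fst l = fst l'" using assms by simp
  with * show ?thesis by (simp add: prod_eq_iff)
qed

lemma chord_on_line:
  assumes "u \<in> on_line X Y l" "v \<in> on_line X Y l" "u < v"
  shows "chord Y (u, v) t = fst l * t + snd l"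
proof -
  have Y: "Y u = fst l * u + snd l" "Y v = fst l * v + snd l" using assms by (auto simp: on_line_def)
  have "(Y v - Y u) / (v - u) = fst l" unfolding Y using assms by (simp add: field_simps)
  then show ?thesis unfolding chord_def using Y by (simp add: algebra_simps)
qed

text \<open>Szekely's argument: the graph of neighbours has at least \<open>k / 2\<close> edges per
  line, and at most one crossing for each ordered pair of lines, which the crossing lemma turns into
  a bound on the number of lines.\<close>

theorem szemeredi_trotter_plane:
  fixes X :: "real set" and L :: "(real \<times> real) set" and k :: real
  assumes X: "finite X" and L: "finite L" and k: "k \<ge> 2"
    and rich: "\<And>l. l \<in> L \<Longrightarrow> k \<le> real (card (on_line X Y l))"
  shows "real (card L) \<le> 576 * (real (card X) ^ 2 / k ^ 3 + real (card X) / k)"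
proof -
  let ?C = "\<lambda>l. consecutive (on_line X Y l)"
  define E where "E = (\<Union>l\<in>L. ?C l)"
  define N where "N = {(e, e'). e \<in> E \<and> e' \<in> E \<and> crosses Y e e'}"
  have fin: "finite (on_line X Y l)" for l using X by (auto simp: on_line_def)
  have E: "finite E" unfolding E_def using L fin finite_consecutive by blast
  have lab_unique: "l = l'" if "e \<in> ?C l" "e \<in> ?C l'" for e l l'
    using that on_line_unique[of "fst e" X Y l "snd e" l'] by (auto simp: consecutive_def)
  have chord_C: "chord Y e t = fst l * t + snd l" if "e \<in> ?C l" for e l t
    using that chord_on_line[of "fst e" X Y l "snd e" t] by (auto simp: consecutive_def)
  have E_sub: "u \<in> X \<and> v \<in> X \<and> u < v" if "(u, v) \<in> E" for u v
    using that by (auto simp: E_def consecutive_def on_line_def)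
  have no_vertex: "chord Y (u, v) t \<noteq> Y t" if "(u, v) \<in> E" "t \<in> X" "u < t" "t < v" for u v t
  proof
    assume eq: "chord Y (u, v) t = Y t"
    obtain l where l: "(u, v) \<in> ?C l" using \<open>(u, v) \<in> E\<close> unfolding E_def by blast
    with eq chord_C have "t \<in> on_line X Y l" using that by (auto simp: on_line_def)
    with l that show False by (auto simp: consecutive_def)
  qed
  \<comment> \<open>The abscissa of the crossing is given as an expression in the two lines alone,
    so that a pair of lines determines it.\<close>
  have cross: "\<exists>l l' t. l \<in> L \<and> l' \<in> L \<and> fst l \<noteq> fst l' \<and> t = (snd l' - snd l) / (fst l - fst l') \<and> e \<in> ?C l \<and> e' \<in> ?C l'
      \<and> fst e < t \<and> t < snd e \<and> fst e' < t \<and> t < snd e'"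
    if "(e, e') \<in> N" for e e'
  proof -
    obtain l l' where l: "l \<in> L" "l' \<in> L" "e \<in> ?C l" "e' \<in> ?C l'" using \<open>(e, e') \<in> N\<close> unfolding E_def N_def by blast
    obtain t where ne: "e \<noteq> e'" and t: "fst e < t" "t < snd e" "fst e' < t" "t < snd e'" "chord Y e t = chord Y e' t"
      using \<open>(e, e') \<in> N\<close> by (auto simp: N_def crosses_def)
    have "l \<noteq> l'" using consecutive_unique[of "fst e" "snd e" "on_line X Y l" "fst e'" "snd e'" t] l t ne by auto
    moreover have eq: "fst l * t + snd l = fst l' * t + snd l'" using chord_C l t by metis
    ultimately have "fst l \<noteq> fst l'" by (auto simp: prod_eq_iff)
    moreover from this eq have "t = (snd l' - snd l) / (fst l - fst l')" by (simp add: field_simps)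
    ultimately show ?thesis using l t by blast
  qed
  have ends: "{u, v} \<inter> {u', v'} = {}"
    if "(u, v) \<in> E" "(u', v') \<in> E" "crosses Y (u, v) (u', v')" for u v u' v'
  proof -
    have "((u, v), (u', v')) \<in> N" using that by (auto simp: N_def)
    from cross[OF this] obtain l l' t where l: "fst l \<noteq> fst l'" "t = (snd l' - snd l) / (fst l - fst l')"
      "(u, v) \<in> ?C l" "(u', v') \<in> ?C l'" "u < t" "t < v" "u' < t" "t < v'" by auto
    have "x = t" if "x \<in> on_line X Y l" "x \<in> on_line X Y l'" for x
    proof -
      have "fst l * x + snd l = fst l' * x + snd l'" using that by (auto simp: on_line_def)
      then have "x * (fst l - fst l') = snd l' - snd l" by (simp add: algebra_simps)
      then show ?thesis using l(1) unfolding l(2) by (simp add: eq_divide_eq)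
    qed
    then show ?thesis using l by (auto simp: consecutive_def)
  qed
  \<comment> \<open>Sending a crossing to its pair of lines is injective: the lines fix the
    abscissa, and at most one edge of a line spans it.\<close>
  have N_le: "card N \<le> card L ^ 2"
  proof -
    define lab where "lab = (\<lambda>e. THE l. e \<in> ?C l)"
    have lab: "lab e = l" if "e \<in> ?C l" for e l
      unfolding lab_def using that lab_unique by (intro the_equality) auto
    have "card N \<le> card (L \<times> L)"
    proof (rule card_inj_on_le[of "map_prod lab lab"])
      show "map_prod lab lab ` N \<subseteq> L \<times> L" using cross lab by fastforce
      show "inj_on (map_prod lab lab) N"
      proof (rule inj_onI, clarify)
        fix a b a' b' assume N: "(a, b) \<in> N" "(a', b') \<in> N" "map_prod lab lab (a, b) = map_prod lab lab (a', b')"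
        obtain l m where 1: "a \<in> ?C l" "b \<in> ?C m" and
          t: "fst a < (snd m - snd l) / (fst l - fst m)" "(snd m - snd l) / (fst l - fst m) < snd a"
          "fst b < (snd m - snd l) / (fst l - fst m)" "(snd m - snd l) / (fst l - fst m) < snd b"
          using cross[OF N(1)] by metis
        obtain l' m' where 2: "a' \<in> ?C l'" "b' \<in> ?C m'" and
          t': "fst a' < (snd m' - snd l') / (fst l' - fst m')" "(snd m' - snd l') / (fst l' - fst m') < snd a'"
          "fst b' < (snd m' - snd l') / (fst l' - fst m')" "(snd m' - snd l') / (fst l' - fst m') < snd b'"
          using cross[OF N(2)] by metis
        have same: "l' = l" "m' = m" using lab 1 2 N(3) by auto
        show "a = a' \<and> b = b'"
          using consecutive_unique[of "fst a" "snd a" _ "fst a'" "snd a'"]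
            consecutive_unique[of "fst b" "snd b" _ "fst b'" "snd b'"] 1 2 t t'
          unfolding same by auto
      qed
    qed (use L in auto)
    then show ?thesis by (simp add: card_cartesian_product power2_eq_square)
  qed
  have "k / 2 * real (card L) \<le> (\<Sum>l\<in>L. real (card (?C l)))"
  proof -
    \<comment> \<open>This is \<open>k - 1 \<ge> k / 2\<close>, from
      \<open>k \<ge> 2\<close>.\<close>
    have "k / 2 \<le> real (card (?C l))" if "l \<in> L" for l
      using card_consecutive_ge[OF fin, of l] rich[OF that] k by linarith
    then have "(\<Sum>l\<in>L. k / 2) \<le> (\<Sum>l\<in>L. real (card (?C l)))" by (rule sum_mono)
    then show ?thesis by (simp add: mult.commute)
  qed
  also have "\<dots> = real (card E)"
  proof -
    have "card E = (\<Sum>l\<in>L. card (?C l))" unfolding E_def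
      using L fin finite_consecutive lab_unique by (intro card_UN_disjoint) blast+
    then show ?thesis by simp
  qed
  finally have kE: "k / 2 * real (card L) \<le> real (card E)" .
  define m where "m = real (card X)"
  define e where "e = real (card E)"
  define L' where "L' = real (card L)"
  have nn: "m \<ge> 0" "L' \<ge> 0" by (auto simp: m_def L'_def)
  show ?thesis
  proof (cases "e \<le> 6 * m")
    case True
    then have "L' \<le> 12 * (m / k)" using kE k by (simp add: field_simps L'_def e_def)
    also have "\<dots> \<le> 576 * (m ^ 2 / k ^ 3 + m / k)"
    proof -
      have "0 \<le> m ^ 2 / k ^ 3" "0 \<le> m / k" using nn k by auto
      then show ?thesis by argo
    qed
    finally show ?thesis by (simp add: m_def L'_def)
  next
    case False
    \<comment> \<open>Then \<open>p ^ 2 * e = 6 * p * m\<close> is twice the linear term of the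
      crossing lemma, so crossings must pay for the other half. The case split at
      \<open>6 * m\<close> guarantees \<open>p \<le> 1\<close>.\<close>
    define p where "p = 6 * m / e"
    have e0: "e > 0" using False nn by linarith
    then have p: "0 \<le> p" "p \<le> 1" using False nn by (auto simp: p_def field_simps)
    have N2: "real (card N) \<le> L' ^ 2" using N_le unfolding L'_def by (metis of_nat_le_iff of_nat_power)
    have "p ^ 2 * e \<le> 3 * p * m + p ^ 4 * real (card N)"
      unfolding e_def m_def N_def
      using crossing_lemma[OF X E_sub no_vertex ends p] by simp
    also have "\<dots> \<le> 3 * p * m + p ^ 4 * L' ^ 2"
      using N2 p by (intro add_left_mono mult_left_mono) auto
    finally have 1: "p ^ 2 * e \<le> 3 * p * m + p ^ 4 * L' ^ 2" .
    have m0: "m > 0"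
    proof (rule ccontr)
      assume "\<not> m > 0"
      then have "X = {}" using nn X by (simp add: m_def)
      then have "E = {}" using E_sub by (metis empty_iff equals0I surj_pair)
      then show False using e0 by (simp add: e_def)
    qed
    then have p0: "p > 0" using e0 by (simp add: p_def)
    have pe: "p * e = 6 * m" using e0 by (simp add: p_def)
    have "p * (p * e) \<le> p * (3 * m + p ^ 3 * L' ^ 2)"
      using 1 by (simp add: algebra_simps power2_eq_square power3_eq_cube power4_eq_xxxx)
    then have "6 * m \<le> 3 * m + p ^ 3 * L' ^ 2" using p0 unfolding pe by simp
    then have "3 * m * e ^ 3 \<le> p ^ 3 * L' ^ 2 * e ^ 3" using e0 by (intro mult_right_mono) auto
    also have "\<dots> = (p * e) ^ 3 * L' ^ 2" by (simp add: power_mult_distrib)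
    also have "\<dots> = m * (216 * m ^ 2 * L' ^ 2)"
      unfolding pe by (simp add: power_mult_distrib power2_eq_square power3_eq_cube)
    finally have "m * (3 * e ^ 3) \<le> m * (216 * m ^ 2 * L' ^ 2)" by (simp add: algebra_simps)
    then have e3: "e ^ 3 \<le> 72 * m ^ 2 * L' ^ 2" using m0 by (simp add: mult_ac)
    \<comment> \<open>Cubing \<open>k / 2\<close> contributes the factor 8, and
      \<open>8 * 72 = 576\<close>.\<close>
    have "(k / 2 * L') ^ 3 \<le> e ^ 3" using kE k nn by (intro power_mono) (auto simp: e_def L'_def)
    with e3 have "L' ^ 2 * (k ^ 3 * L') \<le> L' ^ 2 * (576 * m ^ 2)"
      by (simp add: power_mult_distrib power_divide power2_eq_square power3_eq_cube algebra_simps)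
    then have "L' = 0 \<or> k ^ 3 * L' \<le> 576 * m ^ 2"
      by (metis mult_le_cancel_left_pos nn(2) order_less_le zero_less_power)
    then have "L' \<le> 576 * (m ^ 2 / k ^ 3)" using k nn by (auto simp: field_simps)
    also have "\<dots> \<le> 576 * (m ^ 2 / k ^ 3 + m / k)" using nn k by simp
    finally show ?thesis by (simp add: m_def L'_def)
  qed
qed

section \<open>Szemeredi--Trotter for two-dimensional subspaces\<close>

text \<open>Move \<open>a\<close> in the direction of the new vector \<open>z\<close>: a vector
  orthogonal to \<open>z\<close> keeps its nonzero value, and every other one excludes a single
  \<open>t\<close>.\<close>

lemma exists_functional_nonzero:
  fixes Z :: "'a::euclidean_space set"
  assumes "finite Z" "0 \<notin> Z"
  shows "\<exists>a. \<forall>z\<in>Z. a \<bullet> z \<noteq> 0"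
  using assms
proof (induction Z)
  case (insert z Z)
  then obtain a where a: "\<forall>y\<in>Z. a \<bullet> y \<noteq> 0" by auto
  have "finite (insert (- (a \<bullet> z) / (z \<bullet> z)) ((\<lambda>y. - (a \<bullet> y) / (z \<bullet> y)) ` Z))" using insert by simp
  then obtain t where t: "t \<notin> insert (- (a \<bullet> z) / (z \<bullet> z)) ((\<lambda>y. - (a \<bullet> y) / (z \<bullet> y)) ` Z)"
    using ex_new_if_finite[OF infinite_UNIV_char_0[where 'a = real]] by blast
  have "(a + t *\<^sub>R z) \<bullet> y \<noteq> 0" if "y \<in> insert z Z" for y
  proof
    assume 0: "(a + t *\<^sub>R z) \<bullet> y = 0"
    show False
    proof (cases "z \<bullet> y = 0")
      case True
      then have "y \<in> Z" using that insert by auto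
      then show False using a 0 True by (simp add: inner_add_left)
    next
      case False
      then have "t = - (a \<bullet> y) / (z \<bullet> y)" using 0 by (simp add: inner_add_left field_simps)
      then show False using t that by auto
    qed
  qed
  then show ?case by blast
qed simp

text \<open>Vectors representing pairwise distinct points of projective space.\<close>

definition projective_set :: "'a::real_vector set \<Rightarrow> bool" where
  "projective_set V \<longleftrightarrow> finite V \<and> 0 \<notin> V \<and> (\<forall>u\<in>V. \<forall>v\<in>V. v \<in> span {u} \<longrightarrow> v = u)"

lemma projective_setD:
  assumes "projective_set V"
  shows "finite V" "0 \<notin> V" "\<And>u v. u \<in> V \<Longrightarrow> v \<in> V \<Longrightarrow> v \<in> span {u} \<Longrightarrow> v = u"
  using assms by (auto simp: projective_set_def)

lemma projective_set_subset: "projective_set V \<Longrightarrow> U \<subseteq> V \<Longrightarrow> projective_set U"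
  unfolding projective_set_def by (meson finite_subset subsetD)

lemma projective_independent:
  assumes "projective_set V" "u \<in> V" "v \<in> V" "u \<noteq> v"
  shows "independent {u, v}"
proof -
  have "v \<notin> span {u}" "u \<noteq> 0" using projective_setD[OF assms(1)] assms(2-4) by metis+
  then have "independent (insert v {u})"
    by (metis independent_insertI independent_empty span_empty singletonD)
  then show ?thesis by (simp add: insert_commute)
qed

lemma dim2_eq_span:
  fixes G :: "'a::euclidean_space set"
  assumes "projective_set V" "u \<in> V" "v \<in> V" "u \<noteq> v" "subspace G" "dim G = 2" "u \<in> G" "v \<in> G"
  shows "G = span {u, v}"
proof (rule sym, rule subspace_dim_equal)
  show "span {u, v} \<subseteq> G" using assms by (intro span_minimal) auto
  show "dim (span {u, v}) \<ge> dim G"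
    using dim_span_eq_card_independent[OF projective_independent[OF assms(1-4)]] assms by simp
qed (use assms in auto)

text \<open>A generic projection to the plane has coordinates \<open>f / h\<close> and
  \<open>g / h\<close>. The functional \<open>h\<close> keeps all points off the line at infinity,
  \<open>f\<close> makes the abscissae distinct, and \<open>g\<close> prevents different subspaces
  from having the same image line. Each requirement excludes the zeros of a functional on finitely
  many nonzero vectors.\<close>

theorem szemeredi_trotter_projective:
  fixes V :: "'a::euclidean_space set" and k :: real
  assumes V: "projective_set V" and k: "k \<ge> 2"
    and \<G>: "\<And>G. G \<in> \<G> \<Longrightarrow> subspace G \<and> dim G = 2 \<and> k \<le> real (card (V \<inter> G))"
  shows "finite \<G> \<and> real (card \<G>) \<le> 576 * (real (card V) ^ 2 / k ^ 3 + real (card V) / k)"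
proof
  note Vd = projective_setD[OF V]
  have two: "\<exists>u v. u \<in> V \<and> v \<in> V \<and> u \<in> G \<and> v \<in> G \<and> u \<noteq> v" if "G \<in> \<G>" for G
  proof -
    have "2 \<le> card (V \<inter> G)" using \<G>[OF that] k by linarith
    then have "\<exists>A. A \<subseteq> V \<inter> G \<and> card A = 2" by (metis obtain_subset_with_card_n)
    then show ?thesis by (auto simp: card_2_iff)
  qed
  have span_eq: "G = span {u, v}" if "G \<in> \<G>" "u \<in> V" "v \<in> V" "u \<in> G" "v \<in> G" "u \<noteq> v" for G u v
    using dim2_eq_span[OF V] that \<G> by blast
  have "\<G> \<subseteq> (\<lambda>(u, v). span {u, v}) ` (V \<times> V)"
  proof
    fix G assume G: "G \<in> \<G>"
    obtain u v where uv: "u \<in> V" "v \<in> V" "u \<in> G" "v \<in> G" "u \<noteq> v" using two[OF G] by blast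
    then have "G = span {u, v}" using span_eq[OF G] by blast
    then show "G \<in> (\<lambda>(u, v). span {u, v}) ` (V \<times> V)" using uv by auto
  qed
  then show fin: "finite \<G>" using Vd(1) by (meson finite_SigmaI finite_imageI finite_subset)
  obtain h :: 'a where h: "\<And>v. v \<in> V \<Longrightarrow> h \<bullet> v \<noteq> 0" using exists_functional_nonzero[OF Vd(1,2)] by blast
  \<comment> \<open>The ratios \<open>f / h\<close> at \<open>u\<close> and \<open>v\<close> agree
    exactly when \<open>f\<close> vanishes on such a vector.\<close>
  define Z1 where "Z1 = (\<lambda>(u, v). (h \<bullet> u) *\<^sub>R v - (h \<bullet> v) *\<^sub>R u) ` {(u, v). u \<in> V \<and> v \<in> V \<and> u \<noteq> v}"
  have "finite Z1" unfolding Z1_def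
    by (intro finite_imageI, rule finite_subset[of _ "V \<times> V"]) (use Vd(1) in auto)
  moreover have "0 \<notin> Z1"
  proof
    assume "0 \<in> Z1"
    then obtain u v where uv: "u \<in> V" "v \<in> V" "u \<noteq> v" "(h \<bullet> u) *\<^sub>R v = (h \<bullet> v) *\<^sub>R u"
      by (auto simp: Z1_def)
    have "v = (1 / (h \<bullet> u)) *\<^sub>R ((h \<bullet> u) *\<^sub>R v)" using h[OF uv(1)] by simp
    then have "v = (1 / (h \<bullet> u)) *\<^sub>R ((h \<bullet> v) *\<^sub>R u)" by (simp only: uv(4))
    then have "v \<in> span {u}" by (metis span_base span_mul insertI1)
    then show False using Vd(3)[OF uv(1,2)] uv(3) by blast
  qed
  ultimately obtain f :: 'a where f: "\<forall>z\<in>Z1. f \<bullet> z \<noteq> 0" using exists_functional_nonzero by blast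
  have f: "(h \<bullet> u) * (f \<bullet> v) - (h \<bullet> v) * (f \<bullet> u) \<noteq> 0" if "u \<in> V" "v \<in> V" "u \<noteq> v" for u v
  proof -
    have "(h \<bullet> u) *\<^sub>R v - (h \<bullet> v) *\<^sub>R u \<in> Z1" using that by (auto simp: Z1_def)
    from f[rule_format, OF this] show ?thesis by (simp add: inner_diff_right)
  qed
  \<comment> \<open>\<open>g \<bullet> z u v w\<close> is the 3 by 3 determinant with rows
    \<open>h\<close>, \<open>f\<close>, \<open>g\<close> evaluated at \<open>u\<close>,
    \<open>v\<close>, \<open>w\<close>, expanded along the row of \<open>g\<close>. As
    \<open>f\<close> has already been chosen, the coefficient of \<open>w\<close> is nonzero for
    \<open>u \<noteq> v\<close> in \<open>V\<close>.\<close>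
  define z where "z = (\<lambda>u v w. ((h \<bullet> v) * (f \<bullet> w) - (h \<bullet> w) * (f \<bullet> v)) *\<^sub>R u
      + ((h \<bullet> w) * (f \<bullet> u) - (h \<bullet> u) * (f \<bullet> w)) *\<^sub>R v + ((h \<bullet> u) * (f \<bullet> v) - (h \<bullet> v) * (f \<bullet> u)) *\<^sub>R w)"
  define T where "T = {(u, v, w). u \<in> V \<and> v \<in> V \<and> w \<in> V \<and> u \<noteq> v \<and> w \<notin> span {u, v}}"
  have "finite T" by (rule finite_subset[of _ "V \<times> V \<times> V"]) (use Vd(1) in \<open>auto simp: T_def\<close>)
  moreover have "0 \<notin> (\<lambda>(u, v, w). z u v w) ` T"
  proof
    assume "0 \<in> (\<lambda>(u, v, w). z u v w) ` T"
    then obtain u v w where T: "u \<in> V" "v \<in> V" "w \<in> V" "u \<noteq> v" "w \<notin> span {u, v}" and 0: "z u v w = 0"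
      by (auto simp: T_def)
    define c where "c = (h \<bullet> u) * (f \<bullet> v) - (h \<bullet> v) * (f \<bullet> u)"
    define y where "y = ((h \<bullet> v) * (f \<bullet> w) - (h \<bullet> w) * (f \<bullet> v)) *\<^sub>R u + ((h \<bullet> w) * (f \<bullet> u) - (h \<bullet> u) * (f \<bullet> w)) *\<^sub>R v"
    have c: "c \<noteq> 0" using f T by (simp add: c_def)
    have "y + c *\<^sub>R w = 0" using 0 by (simp add: z_def y_def c_def)
    then have "c *\<^sub>R w = - y" by (simp add: eq_neg_iff_add_eq_0 add.commute)
    have "w = (1 / c) *\<^sub>R (c *\<^sub>R w)" using c by simp
    then have "w = (1 / c) *\<^sub>R (- y)" by (simp only: \<open>c *\<^sub>R w = - y\<close>)
    moreover have "y \<in> span {u, v}" unfolding y_def by (intro span_add span_mul span_base) auto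
    ultimately have "w \<in> span {u, v}" by (simp add: span_mul span_neg)
    then show False using T by simp
  qed
  ultimately obtain g :: 'a where g: "\<forall>y\<in>(\<lambda>(u, v, w). z u v w) ` T. g \<bullet> y \<noteq> 0"
    using exists_functional_nonzero by blast
  define x where "x = (\<lambda>v. (f \<bullet> v) / (h \<bullet> v))"
  define X where "X = x ` V"
  define Y where "Y = (\<lambda>t. (g \<bullet> (inv_into V x t)) / (h \<bullet> (inv_into V x t)))"
  have inj: "inj_on x V"
  proof (rule inj_onI, rule ccontr)
    fix u v assume "u \<in> V" "v \<in> V" "x u = x v" "u \<noteq> v"
    then show False using f[of u v] h[of u] h[of v] by (simp add: x_def field_simps)
  qed
  have line_ex: "\<exists>l. \<forall>w\<in>G. g \<bullet> w = fst l * (f \<bullet> w) + snd l * (h \<bullet> w)" if G: "G \<in> \<G>" for G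
  proof -
    obtain u v where uv: "u \<in> V" "v \<in> V" "u \<in> G" "v \<in> G" "u \<noteq> v" using two G by blast
    define D where "D = (h \<bullet> u) * (f \<bullet> v) - (h \<bullet> v) * (f \<bullet> u)"
    have D: "D \<noteq> 0" using f uv by (simp add: D_def)
    \<comment> \<open>Cramer's rule for expressing \<open>g\<close> through \<open>f\<close> and
      \<open>h\<close> on the basis \<open>u\<close>, \<open>v\<close> of \<open>G\<close>; the
      coefficients are the slope and intercept of the image line.\<close>
    define \<alpha> where "\<alpha> = ((h \<bullet> u) * (g \<bullet> v) - (h \<bullet> v) * (g \<bullet> u)) / D"
    define \<beta> where "\<beta> = ((g \<bullet> u) * (f \<bullet> v) - (g \<bullet> v) * (f \<bullet> u)) / D"
    have "D * (g \<bullet> u) = D * (\<alpha> * (f \<bullet> u) + \<beta> * (h \<bullet> u))" "D * (g \<bullet> v) = D * (\<alpha> * (f \<bullet> v) + \<beta> * (h \<bullet> v))"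
      using D by (simp_all add: \<alpha>_def \<beta>_def distrib_left) (simp_all add: D_def algebra_simps)
    then have "g \<bullet> u = \<alpha> * (f \<bullet> u) + \<beta> * (h \<bullet> u)" "g \<bullet> v = \<alpha> * (f \<bullet> v) + \<beta> * (h \<bullet> v)" using D by auto
    then have "(g - \<alpha> *\<^sub>R f - \<beta> *\<^sub>R h) \<bullet> u = 0" "(g - \<alpha> *\<^sub>R f - \<beta> *\<^sub>R h) \<bullet> v = 0" by (simp_all add: inner_diff_left)
    then have "{u, v} \<subseteq> {w. (g - \<alpha> *\<^sub>R f - \<beta> *\<^sub>R h) \<bullet> w = 0}" by auto
    then have "span {u, v} \<subseteq> {w. (g - \<alpha> *\<^sub>R f - \<beta> *\<^sub>R h) \<bullet> w = 0}" by (rule span_minimal) (rule subspace_hyperplane)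
    moreover have "G = span {u, v}" using span_eq G uv by blast
    ultimately have "g \<bullet> w = \<alpha> * (f \<bullet> w) + \<beta> * (h \<bullet> w)" if "w \<in> G" for w
      using that by (force simp: inner_diff_left)
    then show ?thesis by (intro exI[of _ "(\<alpha>, \<beta>)"]) auto
  qed
  then obtain l where l: "\<And>G w. G \<in> \<G> \<Longrightarrow> w \<in> G \<Longrightarrow> g \<bullet> w = fst (l G) * (f \<bullet> w) + snd (l G) * (h \<bullet> w)" by metis
  have inj_l: "inj_on l \<G>"
  proof (rule inj_onI, rule ccontr)
    fix G G' assume G: "G \<in> \<G>" "G' \<in> \<G>" "l G = l G'" "G \<noteq> G'"
    obtain u v where uv: "u \<in> V" "v \<in> V" "u \<in> G" "v \<in> G" "u \<noteq> v" using two G by blast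
    obtain u' v' where uv': "u' \<in> V" "v' \<in> V" "u' \<in> G'" "v' \<in> G'" "u' \<noteq> v'" using two G by blast
    \<comment> \<open>If \<open>G\<close> and \<open>G'\<close> had the same image line, a point
      \<open>w\<close> of \<open>G'\<close> outside \<open>G\<close> would make the determinant
      vanish, against the choice of \<open>g\<close>.\<close>
    have "\<not> (u' \<in> G \<and> v' \<in> G)" using span_eq[of G u' v'] span_eq[of G' u' v'] G uv' by blast
    then obtain w where w: "w \<in> V" "w \<in> G'" "w \<notin> G" using uv' by blast
    have "(u, v, w) \<in> T" using uv w span_eq[of G u v] G by (auto simp: T_def)
    then have "g \<bullet> z u v w \<noteq> 0" using g by force
    moreover have "g \<bullet> u = fst (l G) * (f \<bullet> u) + snd (l G) * (h \<bullet> u)" "g \<bullet> v = fst (l G) * (f \<bullet> v) + snd (l G) * (h \<bullet> v)"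
      "g \<bullet> w = fst (l G) * (f \<bullet> w) + snd (l G) * (h \<bullet> w)"
      using l uv w G by auto
    then have "g \<bullet> z u v w = 0" by (simp add: z_def inner_add_right algebra_simps)
    ultimately show False by simp
  qed
  have rich: "k \<le> real (card (on_line X Y (l G)))" if G: "G \<in> \<G>" for G
  proof -
    have "x ` (V \<inter> G) \<subseteq> on_line X Y (l G)"
    proof clarify
      fix w assume w: "w \<in> V" "w \<in> G"
      have "Y (x w) = (g \<bullet> w) / (h \<bullet> w)" using w inj by (simp add: Y_def)
      also have "\<dots> = fst (l G) * x w + snd (l G)" using l[OF G w(2)] h[OF w(1)] by (simp add: x_def field_simps)
      finally show "x w \<in> on_line X Y (l G)" using w by (auto simp: on_line_def X_def)
    qed
    then have "card (x ` (V \<inter> G)) \<le> card (on_line X Y (l G))"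
      using Vd(1) by (intro card_mono) (auto simp: on_line_def X_def)
    moreover have "card (x ` (V \<inter> G)) = card (V \<inter> G)" using inj by (intro card_image) (auto intro: inj_on_subset)
    ultimately show ?thesis using \<G>[OF G] by linarith
  qed
  have "real (card (l ` \<G>)) \<le> 576 * (real (card X) ^ 2 / k ^ 3 + real (card X) / k)"
  proof (rule szemeredi_trotter_plane)
    show "k \<le> real (card (on_line X Y m))" if "m \<in> l ` \<G>" for m using that rich by blast
  qed (use fin k Vd(1) in \<open>auto simp: X_def\<close>)
  moreover have "card (l ` \<G>) = card \<G>" "card X = card V"
    using inj inj_l by (simp_all add: card_image X_def)
  ultimately show "real (card \<G>) \<le> 576 * (real (card V) ^ 2 / k ^ 3 + real (card V) / k)" by simp
qed

section \<open>Projection from a point\<close>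

definition proj_away :: "'a::euclidean_space \<Rightarrow> 'a \<Rightarrow> 'a" where
  "proj_away p v = v - ((p \<bullet> v) / (p \<bullet> p)) *\<^sub>R p"

lemma linear_proj_away: "linear (proj_away p)"
  by (rule linearI) (simp_all add: proj_away_def inner_add_right add_divide_distrib algebra_simps)

lemma inner_proj_away: "p \<noteq> 0 \<Longrightarrow> p \<bullet> proj_away p v = 0"
  by (simp add: proj_away_def inner_diff_right)

lemma proj_away_fix: "p \<bullet> v = 0 \<Longrightarrow> proj_away p v = v"
  by (simp add: proj_away_def)

lemma proj_away_mem_iff:
  assumes "subspace G" "p \<in> G"
  shows "proj_away p v \<in> G \<longleftrightarrow> v \<in> G"
proof
  have *: "c *\<^sub>R p \<in> G" for c using assms by (simp add: subspace_scale)
  show "v \<in> G" if "proj_away p v \<in> G"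
    using subspace_add[OF assms(1) that *[of "(p \<bullet> v) / (p \<bullet> p)"]] by (simp add: proj_away_def)
  show "proj_away p v \<in> G" if "v \<in> G"
    using subspace_diff[OF assms(1) that *[of "(p \<bullet> v) / (p \<bullet> p)"]] by (simp add: proj_away_def)
qed

text \<open>Stands for the quotient of \<open>G\<close> by the line of \<open>p\<close>. Realising
  it as an orthogonal complement inside the same space lets the induction on the dimension stay in
  one type.\<close>

definition link :: "'a::euclidean_space \<Rightarrow> 'a set \<Rightarrow> 'a set" where
  "link p G = {y \<in> G. p \<bullet> y = 0}"

lemma subspace_link: "subspace G \<Longrightarrow> subspace (link p G)"
  unfolding link_def by (auto simp: subspace_def inner_add_right)

lemma dim_link:
  assumes "subspace G" "p \<in> G" "p \<noteq> 0"
  shows "dim (link p G) + 1 = dim G"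
proof -
  have "dim {y \<in> G. \<forall>x\<in>span {p}. orthogonal x y} + dim (span {p}) = dim G"
    using assms by (intro dim_subspace_orthogonal_to_vectors) (auto intro: span_minimal[THEN subsetD])
  moreover have "{y \<in> G. \<forall>x\<in>span {p}. orthogonal x y} = link p G"
    by (auto simp: link_def span_singleton orthogonal_def)
  ultimately show ?thesis using assms by (simp add: dim_singleton)
qed

lemma proj_away_mem_link:
  assumes "subspace G" "p \<in> G" "p \<noteq> 0"
  shows "proj_away p v \<in> link p G \<longleftrightarrow> v \<in> G"
  using proj_away_mem_iff[OF assms(1,2)] inner_proj_away[OF assms(3)] by (simp add: link_def)

text \<open>\<open>G\<close> is recovered as the preimage of its link under
  \<open>proj_away p\<close>.\<close>

lemma inj_on_link: "p \<noteq> 0 \<Longrightarrow> inj_on (link p) {G. subspace G \<and> p \<in> G}"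
  by (rule inj_onI) (metis (no_types, lifting) mem_Collect_eq proj_away_mem_link set_eqI)

lemma card_le_fibers:
  fixes B :: real
  assumes "finite A" "\<And>y. y \<in> f ` A \<Longrightarrow> real (card {x \<in> A. f x = y}) \<le> B"
  shows "real (card A) \<le> B * real (card (f ` A))"
proof -
  have "real (card A) = (\<Sum>y\<in>f ` A. real (card {x \<in> A. f x = y}))"
    using sum.image_gen[OF assms(1), of "\<lambda>_. 1::real" f] by simp
  also have "\<dots> \<le> (\<Sum>y\<in>f ` A. B)" using assms(2) by (rule sum_mono)
  finally show ?thesis by (simp add: mult.commute)
qed

definition light :: "real \<Rightarrow> 'a::euclidean_space set \<Rightarrow> 'a \<Rightarrow> 'a set" where
  "light B V p = {q \<in> V. q \<noteq> p \<and> real (card (V \<inter> span {p, q})) \<le> B}"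

text \<open>
  \<open>V'\<close> consists of one projected representative for each light line through \<open>p\<close>; discarding the heavy
  lines bounds the multiplicities of the projection by \<open>B\<close>.
\<close>

lemma projection_from_point:
  fixes V :: "'a::euclidean_space set"
  assumes V: "projective_set V" and p: "p \<in> V" and B: "B \<ge> 0"
  shows "\<exists>V'. projective_set V' \<and> card V' \<le> card V \<and>
    (\<forall>G. subspace G \<longrightarrow> p \<in> G \<longrightarrow> real (card (light B V p \<inter> G)) \<le> B * real (card (V' \<inter> link p G))) \<and>
    (\<forall>G W'. subspace G \<longrightarrow> p \<in> G \<longrightarrow> subspace W' \<longrightarrow> W' \<subseteq> link p G \<longrightarrow>
      (\<exists>W. subspace W \<and> W \<subseteq> G \<and> dim W = dim W' + 1 \<and> card (V' \<inter> W') \<le> card (V \<inter> W)))"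
proof -
  note Vd = projective_setD[OF V]
  have p0: "p \<noteq> 0" using Vd(2) p by blast
  define f where "f = (\<lambda>q. span {p, q})"
  define Q where "Q = light B V p"
  have Q: "Q \<subseteq> V" "p \<notin> Q" "finite Q" using Vd(1) by (auto simp: Q_def light_def)
  obtain R where R: "R \<subseteq> Q" "inj_on f R" "f ` Q = f ` R"
    using iffD1[OF subset_image_inj order_refl[of "f ` Q"]] by auto
  have RV: "R \<subseteq> V" "p \<notin> R" "finite R" using R Q by (auto intro: finite_subset)
  have dim2: "dim {p, q} = 2" if "q \<in> V" "q \<noteq> p" for q
    using dim_eq_card_independent[OF projective_independent[OF V p that(1)]] that by simp
  have same: "q = r" if "q \<in> R" "r \<in> R" "proj_away p q \<in> span {proj_away p r}" for q r
  proof -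
    have "span {proj_away p r} \<subseteq> span {p, r}"
      using proj_away_mem_iff[of "span {p, r}" p r] by (intro span_minimal) (auto simp: span_base)
    then have "q \<in> span {p, r}" using that(3) proj_away_mem_iff[of "span {p, r}" p q] by (auto simp: span_base)
    then have "span {p, r} = span {p, q}"
      using that RV dim2[of r] by (intro dim2_eq_span[OF V p]) (auto simp: span_base)
    then show ?thesis using inj_onD[OF R(2), of q r] that by (simp add: f_def)
  qed
  have inj: "inj_on (proj_away p) R" by (rule inj_onI, rule same) (auto simp: span_base)
  define V' where "V' = proj_away p ` R"
  have "projective_set V'" unfolding projective_set_def
  proof (intro conjI ballI impI)
    show "finite V'" using RV by (simp add: V'_def)
    show "0 \<notin> V'"
    proof
      assume "0 \<in> V'"
      then obtain r where r: "r \<in> R" "proj_away p r \<in> span {p}" by (auto simp: V'_def span_zero)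
      then have "r \<in> span {p}" using proj_away_mem_iff[of "span {p}" p r] by (auto simp: span_base)
      then show False using Vd(3)[OF p, of r] r RV by blast
    qed
    show "v = u" if "u \<in> V'" "v \<in> V'" "v \<in> span {u}" for u v
      using that same by (auto simp: V'_def)
  qed
  moreover have "card V' \<le> card V"
    using inj RV Vd(1) by (simp add: V'_def card_image card_mono)
  moreover have "real (card (light B V p \<inter> G)) \<le> B * real (card (V' \<inter> link p G))"
    if G: "subspace G" "p \<in> G" for G
  proof -
    have in_G: "f q \<subseteq> G" if "q \<in> G" for q unfolding f_def using that G by (intro span_minimal) auto
    have self: "q \<in> f q" for q by (simp add: f_def span_base)
    have img: "f ` (Q \<inter> G) \<subseteq> f ` (R \<inter> G)"
    proof
      fix l assume "l \<in> f ` (Q \<inter> G)"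
      then obtain q where q: "q \<in> Q" "q \<in> G" "l = f q" by auto
      then obtain r where r: "r \<in> R" "f q = f r" using R(3) by (metis image_iff)
      then have "r \<in> G" using in_G[OF q(2)] self[of r] by auto
      then show "l \<in> f ` (R \<inter> G)" using r q by auto
    qed
    have "card (f ` (Q \<inter> G)) \<le> card (f ` (R \<inter> G))" using img RV by (intro card_mono) auto
    also have "\<dots> = card (proj_away p ` (R \<inter> G))"
      using R(2) inj by (simp add: card_image inj_on_Int)
    also have "\<dots> \<le> card (V' \<inter> link p G)"
      using RV proj_away_mem_link[OF G p0] by (intro card_mono) (auto simp: V'_def)
    finally have 1: "card (f ` (Q \<inter> G)) \<le> card (V' \<inter> link p G)" .
    have "real (card (Q \<inter> G)) \<le> B * real (card (f ` (Q \<inter> G)))"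
    proof (rule card_le_fibers)
      fix l assume "l \<in> f ` (Q \<inter> G)"
      then obtain q where q: "q \<in> Q" "l = f q" by auto
      have "{x \<in> Q \<inter> G. f x = l} \<subseteq> V \<inter> l" using Q self by blast
      then have "card {x \<in> Q \<inter> G. f x = l} \<le> card (V \<inter> l)" using Vd(1) by (intro card_mono) auto
      moreover have "real (card (V \<inter> l)) \<le> B" using q by (simp add: Q_def light_def f_def)
      ultimately show "real (card {x \<in> Q \<inter> G. f x = l}) \<le> B" by linarith
    qed (use Q in auto)
    also have "\<dots> \<le> B * real (card (V' \<inter> link p G))" using 1 B by (intro mult_left_mono) auto
    finally show ?thesis by (simp add: Q_def)
  qed
  moreover have "\<exists>W. subspace W \<and> W \<subseteq> G \<and> dim W = dim W' + 1 \<and> card (V' \<inter> W') \<le> card (V \<inter> W)"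
    if G: "subspace G" "p \<in> G" and W': "subspace W'" "W' \<subseteq> link p G" for G W'
  proof -
    \<comment> \<open>The preimage contains \<open>p\<close>, which projects to 0, and therefore has
      one dimension more than \<open>W'\<close>.\<close>
    define W where "W = {x. proj_away p x \<in> W'}"
    have sub: "subspace W" unfolding W_def
      using linear_subspace_vimage[OF linear_proj_away W'(1)] by (simp add: vimage_def)
    have "proj_away p p = 0" using p0 by (simp add: proj_away_def)
    then have pW: "p \<in> W" using W' by (simp add: W_def subspace_0)
    have "W \<subseteq> G" using proj_away_mem_link[OF G p0] W' by (auto simp: W_def)
    moreover have "link p W = W'"
      using W' by (auto simp: link_def W_def proj_away_fix)
    then have "dim W = dim W' + 1" using dim_link[OF sub pW p0] by simp
    moreover have "card (V' \<inter> W') \<le> card (V \<inter> W)"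
    proof -
      have "V' \<inter> W' \<subseteq> proj_away p ` (V \<inter> W)" using RV by (auto simp: V'_def W_def)
      then show ?thesis using Vd(1) by (meson card_image_le card_mono finite_Int finite_imageI le_trans)
    qed
    ultimately show ?thesis using sub by blast
  qed
  ultimately show ?thesis by (intro exI[of _ V']) blast
qed

section \<open>Nondegenerate flats\<close>

lemma power_Suc_diff_le:
  fixes x :: real
  assumes "x \<ge> 0"
  shows "(x + 1) ^ Suc s \<le> x ^ Suc s + real (Suc s) * (x + 1) ^ s"
proof (induction s)
  case (Suc s)
  have "(x + 1) ^ Suc (Suc s) = (x + 1) ^ Suc s + x * (x + 1) ^ Suc s" by (simp add: algebra_simps)
  also have "\<dots> \<le> (x + 1) ^ Suc s + x * (x ^ Suc s + real (Suc s) * (x + 1) ^ s)"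
    using Suc assms by (intro add_left_mono mult_left_mono) auto
  also have "\<dots> = (x + 1) ^ Suc s + x ^ Suc (Suc s) + real (Suc s) * (x * (x + 1) ^ s)"
    by (simp add: algebra_simps)
  also have "\<dots> \<le> (x + 1) ^ Suc s + x ^ Suc (Suc s) + real (Suc s) * ((x + 1) * (x + 1) ^ s)"
    using assms by (intro add_left_mono mult_left_mono mult_right_mono) auto
  finally show ?case by (simp add: algebra_simps)
qed simp

lemma power_le_sum_powers: "real c ^ Suc s \<le> (\<Sum>a=1..c. real (Suc s) * real a ^ s)"
proof (induction c)
  case (Suc c)
  have "real (Suc c) ^ Suc s \<le> real c ^ Suc s + real (Suc s) * real (Suc c) ^ s"
    using power_Suc_diff_le[of "real c" s] by (simp add: add.commute)
  with Suc show ?case by simp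
qed simp

text \<open>Layer-cake summation: replace the power by a sum over levels \<open>a \<le> c G\<close>
  and exchange the sums. It turns bounds on the number of rich flats into bounds on power sums of
  their sizes.\<close>

lemma sum_power_le_rich:
  fixes c :: "'b \<Rightarrow> nat"
  assumes "finite \<G>" "\<And>G. G \<in> \<G> \<Longrightarrow> c G \<le> M"
  shows "(\<Sum>G\<in>\<G>. real (c G) ^ Suc s) \<le> (\<Sum>a=1..M. real (Suc s) * real a ^ s * real (card {G \<in> \<G>. a \<le> c G}))"
proof -
  have "(\<Sum>G\<in>\<G>. real (c G) ^ Suc s) \<le> (\<Sum>G\<in>\<G>. \<Sum>a=1..M. if a \<le> c G then real (Suc s) * real a ^ s else 0)"
  proof (rule sum_mono)
    fix G assume "G \<in> \<G>"
    have "real (c G) ^ Suc s \<le> (\<Sum>a=1..c G. real (Suc s) * real a ^ s)" by (rule power_le_sum_powers)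
    also have "\<dots> = (\<Sum>a=1..c G. if a \<le> c G then real (Suc s) * real a ^ s else 0)"
      by (intro sum.cong) auto
    also have "\<dots> \<le> (\<Sum>a=1..M. if a \<le> c G then real (Suc s) * real a ^ s else 0)"
      using assms(2)[OF \<open>G \<in> \<G>\<close>] by (intro sum_mono2) auto
    finally show "real (c G) ^ Suc s \<le> (\<Sum>a=1..M. if a \<le> c G then real (Suc s) * real a ^ s else 0)" .
  qed
  also have "\<dots> = (\<Sum>a=1..M. \<Sum>G\<in>\<G>. if a \<le> c G then real (Suc s) * real a ^ s else 0)" by (rule sum.swap)
  also have "\<dots> = (\<Sum>a=1..M. real (Suc s) * real a ^ s * real (card {G \<in> \<G>. a \<le> c G}))"
    using assms(1) by (intro sum.cong refl) (simp add: sum.If_cases Int_def)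
  finally show ?thesis .
qed

text \<open>The at most \<open>B\<close> terms with \<open>a \<le> B\<close> are each at most
  \<open>1 / B ^ 2\<close>; beyond \<open>B\<close> the terms are \<open>1 / a ^ 2\<close> and
  telescope.\<close>

lemma sum_truncated_inverse_squares:
  fixes B :: nat
  assumes "B \<ge> 1"
  shows "(\<Sum>a=1..M. real a / real (max a B) ^ 3) \<le> 2 / real B"
proof -
  have small: "(\<Sum>a=1..M. real a / real (max a B) ^ 3) \<le> 1 / real B" if "M \<le> B" for M
  proof -
    have "(\<Sum>a=1..M. real a / real (max a B) ^ 3) \<le> (\<Sum>a=1..M. 1 / real B ^ 2)"
    proof (rule sum_mono)
      fix a assume "a \<in> {1..M}"
      then have a: "a \<le> B" using that by auto
      have "real a / real B ^ 3 \<le> real B / real B ^ 3" using a by (intro divide_right_mono) auto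
      also have "\<dots> = 1 / real B ^ 2" using assms by (simp add: power2_eq_square power3_eq_cube)
      finally show "real a / real (max a B) ^ 3 \<le> 1 / real B ^ 2" using a by (simp add: max_def)
    qed
    also have "\<dots> = real M / real B ^ 2" by simp
    also have "\<dots> \<le> real B / real B ^ 2" using that by (intro divide_right_mono) auto
    finally show ?thesis using assms by (simp add: power2_eq_square)
  qed
  \<comment> \<open>The subtracted \<open>1 / real M\<close> makes the induction step
    telescope.\<close>
  have large: "(\<Sum>a=1..M. real a / real (max a B) ^ 3) \<le> 2 / real B - 1 / real M" if "B \<le> M" for M
    using that
  proof (induction M rule: dec_induct)
    case base
    then show ?case using small[of B] assms by simp
  next
    case (step M)
    have "(\<Sum>a=1..Suc M. real a / real (max a B) ^ 3) = (\<Sum>a=1..M. real a / real (max a B) ^ 3) + real (Suc M) / real (Suc M) ^ 3"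
      using step by (simp add: max_def)
    also have "real (Suc M) / real (Suc M) ^ 3 = 1 / real (Suc M) ^ 2"
      by (simp add: power2_eq_square power3_eq_cube del: of_nat_Suc)
    also have "1 / real (Suc M) ^ 2 \<le> 1 / real M - 1 / real (Suc M)"
      using step assms by (simp add: power2_eq_square divide_simps)
    finally show ?case using step.IH by linarith
  qed
  show ?thesis
  proof (cases "M \<le> B")
    case True
    then show ?thesis using small[OF True] by (smt (verit) divide_right_mono of_nat_0_le_iff)
  next
    case False
    then show ?thesis using large[of M] by (smt (verit) divide_nonneg_nonneg nat_le_linear of_nat_0_le_iff)
  qed
qed

text \<open>A heavy line with a points carries at most a^2 ordered pairs. In the layer-cake sum, the
  cubic term of Szemeredi--Trotter yields the part with \<open>1 / real B\<close>; the linear term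
  contributes \<open>g\<close> at each level, and there are at most \<open>\<delta> * g\<close>
  levels. The constant is \<open>2 * 2 * 576\<close>.\<close>

lemma heavy_pairs_bound:
  fixes X :: "'a::euclidean_space set" and B :: nat
  assumes X: "projective_set X" and B: "B \<ge> 2"
    and \<delta>: "0 \<le> \<delta>" "\<And>p q. p \<in> X \<Longrightarrow> q \<in> X \<Longrightarrow> p \<noteq> q \<Longrightarrow> real (card (X \<inter> span {p, q})) \<le> \<delta> * real (card X)"
  shows "real (card (SIGMA p:X. {q \<in> X. q \<noteq> p \<and> B < card (X \<inter> span {p, q})}))
    \<le> 2304 * (1 / real B + \<delta>) * real (card X) ^ 2"
proof -
  note Xd = projective_setD[OF X]
  define g where "g = real (card X)"
  define H where "H = (SIGMA p:X. {q \<in> X. q \<noteq> p \<and> B < card (X \<inter> span {p, q})})"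
  have H: "finite H" unfolding H_def using Xd(1) by (intro finite_SigmaI) auto
  define \<L> where "\<L> = (\<lambda>(p, q). span {p, q}) ` H"
  define M where "M = nat \<lfloor>\<delta> * g\<rfloor>"
  have g0: "g \<ge> 0" by (simp add: g_def)
  have \<L>: "subspace l \<and> dim l = 2 \<and> B < card (X \<inter> l) \<and> card (X \<inter> l) \<le> M" if l: "l \<in> \<L>" for l
  proof -
    obtain p q where pq: "(p, q) \<in> H" "l = span {p, q}" using l by (auto simp: \<L>_def)
    then have *: "p \<in> X" "q \<in> X" "p \<noteq> q" by (auto simp: H_def)
    have "dim l = 2" using dim_eq_card_independent[OF projective_independent[OF X *]] * pq by simp
    moreover have "card (X \<inter> l) \<le> M" using \<delta>(2)[OF *] pq by (simp add: M_def g_def le_nat_floor)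
    ultimately show ?thesis using pq by (auto simp: H_def)
  qed
  have fin\<L>: "finite \<L>" using H by (simp add: \<L>_def)
  have "H \<subseteq> (\<Union>l\<in>\<L>. (X \<inter> l) \<times> (X \<inter> l))"
  proof
    fix c assume c: "c \<in> H"
    obtain p q where pq: "c = (p, q)" by (cases c)
    have "span {p, q} \<in> \<L>" using c pq by (force simp: \<L>_def)
    moreover have "c \<in> (X \<inter> span {p, q}) \<times> (X \<inter> span {p, q})" using c pq by (auto simp: H_def span_base)
    ultimately show "c \<in> (\<Union>l\<in>\<L>. (X \<inter> l) \<times> (X \<inter> l))" by blast
  qed
  then have "card H \<le> card (\<Union>l\<in>\<L>. (X \<inter> l) \<times> (X \<inter> l))"
    using fin\<L> Xd(1) by (intro card_mono) auto
  also have "\<dots> \<le> (\<Sum>l\<in>\<L>. card ((X \<inter> l) \<times> (X \<inter> l)))" using fin\<L> by (rule card_UN_le)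
  finally have "real (card H) \<le> (\<Sum>l\<in>\<L>. real (card (X \<inter> l)) ^ Suc 1)"
    by (simp add: card_cartesian_product power2_eq_square flip: of_nat_mult of_nat_sum)
  also have "\<dots> \<le> (\<Sum>a=1..M. real (Suc 1) * real a ^ 1 * real (card {l \<in> \<L>. a \<le> card (X \<inter> l)}))"
    using \<L> by (intro sum_power_le_rich fin\<L>) auto
  also have "\<dots> \<le> (\<Sum>a=1..M. 1152 * (g ^ 2 * (real a / real (max a B) ^ 3) + g))"
  proof (rule sum_mono)
    fix a assume "a \<in> {1..M}"
    \<comment> \<open>Lines in \<open>\<L>\<close> have more than \<open>B\<close> points, so levels
      below \<open>B\<close> may use the richness \<open>B\<close>.\<close>
    let ?k = "real (max a B)"
    have k: "?k \<ge> 2" "real a \<le> ?k" using B by auto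
    have "real (card {l \<in> \<L>. a \<le> card (X \<inter> l)}) \<le> 576 * (g ^ 2 / ?k ^ 3 + g / ?k)"
      unfolding g_def using \<L> k(1)
      by (intro szemeredi_trotter_projective[OF X, THEN conjunct2]) (auto simp: less_imp_le)
    then have "2 * real a * real (card {l \<in> \<L>. a \<le> card (X \<inter> l)}) \<le> 2 * real a * (576 * (g ^ 2 / ?k ^ 3 + g / ?k))"
      by (intro mult_left_mono) auto
    also have "\<dots> = 1152 * (g ^ 2 * (real a / ?k ^ 3) + g * (real a / ?k))"
      by (simp add: algebra_simps)
    also have "\<dots> \<le> 1152 * (g ^ 2 * (real a / ?k ^ 3) + g * 1)"
      using k g0 by (intro mult_left_mono add_left_mono) (auto simp: divide_simps)
    finally show "real (Suc 1) * real a ^ 1 * real (card {l \<in> \<L>. a \<le> card (X \<inter> l)})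
        \<le> 1152 * (g ^ 2 * (real a / ?k ^ 3) + g)" by simp
  qed
  also have "\<dots> = 1152 * (g ^ 2 * (\<Sum>a=1..M. real a / real (max a B) ^ 3) + g * real M)"
    by (simp add: sum.distrib sum_distrib_left algebra_simps)
  also have "\<dots> \<le> 1152 * (g ^ 2 * (2 / real B) + g * (\<delta> * g))"
  proof (intro mult_left_mono add_mono)
    show "real M \<le> \<delta> * g" using \<delta>(1) g0 by (simp add: M_def)
    show "(\<Sum>a=1..M. real a / real (max a B) ^ 3) \<le> 2 / real B"
      using B by (intro sum_truncated_inverse_squares) auto
  qed (use g0 in auto)
  also have "\<dots> \<le> 2304 * (1 / real B + \<delta>) * g ^ 2"
    using \<delta>(1) by (simp add: power2_eq_square algebra_simps)
  finally show ?thesis by (simp add: H_def g_def)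
qed

text \<open>The proportion is relative to the points of \<open>G\<close>, not of \<open>V\<close>. A
  subspace of dimension \<open>s\<close> without points of \<open>V\<close> qualifies vacuously,
  hence the recurring condition that \<open>card (V \<inter> G)\<close> is positive.\<close>

definition nondegenerate :: "real \<Rightarrow> nat \<Rightarrow> 'a::euclidean_space set \<Rightarrow> 'a set \<Rightarrow> bool" where
  "nondegenerate \<delta> s V G \<longleftrightarrow> subspace G \<and> dim G = s \<and>
     (\<forall>W. subspace W \<longrightarrow> W \<subseteq> G \<longrightarrow> dim W < s \<longrightarrow> real (card (V \<inter> W)) \<le> \<delta> * real (card (V \<inter> G)))"

lemma nondegenerate_span:
  assumes "nondegenerate \<delta> s V G" "\<delta> < 1" "card (V \<inter> G) > 0"
  shows "G = span (V \<inter> G)"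
proof -
  have G: "subspace G" "dim G = s" using assms(1) by (auto simp: nondegenerate_def)
  have sub: "span (V \<inter> G) \<subseteq> G" using G by (intro span_minimal) auto
  have "\<not> dim (span (V \<inter> G)) < s"
  proof
    assume "dim (span (V \<inter> G)) < s"
    then have "real (card (V \<inter> span (V \<inter> G))) \<le> \<delta> * real (card (V \<inter> G))"
      using assms(1) sub by (auto simp: nondegenerate_def)
    moreover have "V \<inter> span (V \<inter> G) = V \<inter> G" using sub by (auto simp: span_base)
    ultimately show False using assms(2,3) by (auto simp: mult_le_cancel_right1)
  qed
  then show ?thesis using subspace_dim_equal[of "span (V \<inter> G)" G] sub G by auto
qed

text \<open>Such a \<open>G\<close> is the span of its points, hence determined by a subset of
  \<open>V\<close>.\<close>

lemma finite_nondegenerate: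
  assumes "finite V" "\<delta> < 1"
  shows "finite {G. nondegenerate \<delta> s V G \<and> card (V \<inter> G) > 0}"
proof (rule finite_subset)
  show "{G. nondegenerate \<delta> s V G \<and> card (V \<inter> G) > 0} \<subseteq> span ` Pow V"
    using nondegenerate_span[OF _ assms(2)] by (intro subsetI) (auto intro!: rev_image_eqI[of "V \<inter> _"])
  show "finite (span ` Pow V)" using assms(1) by simp
qed

text \<open>The line spanned by one vector of \<open>V\<close> in \<open>G\<close> is a proper
  subspace with exactly one point. This bounds the size of \<open>G\<close> below by
  \<open>1 / \<delta>\<close>.\<close>

lemma nondegenerate_card_ge:
  assumes V: "projective_set V" and G: "nondegenerate \<delta> s V G" "s \<ge> 2" "card (V \<inter> G) > 0"
  shows "1 \<le> \<delta> * real (card (V \<inter> G))"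
proof -
  obtain v where v: "v \<in> V" "v \<in> G" using G(3) by (metis IntE card_gt_0_iff ex_in_conv)
  have "v \<noteq> 0" using projective_setD(2)[OF V] v by blast
  then have "dim (span {v}) < s" using G(2) by simp
  moreover have "span {v} \<subseteq> G" using G(1) v by (intro span_minimal) (auto simp: nondegenerate_def)
  ultimately have "real (card (V \<inter> span {v})) \<le> \<delta> * real (card (V \<inter> G))"
    using G(1) by (simp add: nondegenerate_def)
  moreover have "V \<inter> span {v} = {v}" using projective_setD(3)[OF V, of v] v by (auto simp: span_base)
  ultimately show ?thesis by simp
qed

section \<open>Rich nondegenerate flats\<close>

definition good_points :: "nat \<Rightarrow> 'a::euclidean_space set \<Rightarrow> 'a set \<Rightarrow> 'a set" where
  "good_points B V G = {p \<in> V \<inter> G. real (card (V \<inter> G)) / 2 \<le> real (card (light (real B) V p \<inter> G))}"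

text \<open>
  The analogue of Beck's theorem that drives the projection argument: for most points of \<open>G\<close>, most of the
  others are joined to them by lines with a bounded number of points.
\<close>

lemma many_good_points:
  fixes V :: "'a::euclidean_space set" and B :: nat
  assumes V: "projective_set V" and G: "nondegenerate \<delta> s V G" "s \<ge> 3" "card (V \<inter> G) > 0"
    and \<delta>: "0 < \<delta>" "\<delta> \<le> 1 / 4" "2304 * (1 / real B + \<delta>) \<le> 1 / 16" and B: "B \<ge> 2"
  shows "real (card (V \<inter> G)) / 2 \<le> real (card (good_points B V G))"
proof -
  define X where "X = V \<inter> G"
  define g where "g = real (card X)"
  define hv where "hv = (\<lambda>p. {q \<in> X. q \<noteq> p \<and> B < card (X \<inter> span {p, q})})"
  \<comment> \<open>There are at most \<open>g ^ 2 / 16\<close> heavy pairs, so at most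
    \<open>g / 4\<close> points belong to more than \<open>g / 4\<close> of them as first
    component.\<close>
  define Bad where "Bad = {p \<in> X. g / 4 < real (card (hv p))}"
  have X: "projective_set X" using projective_set_subset[OF V] by (simp add: X_def)
  have finX: "finite X" using projective_setD(1)[OF X] .
  have "\<delta> * g \<le> 1 / 4 * g" using \<delta>(2) by (intro mult_right_mono) (auto simp: g_def)
  \<comment> \<open>Needed later to absorb \<open>p\<close> itself:
    \<open>g - 1 - g / 4 \<ge> g / 2\<close>.\<close>
  then have g4: "g \<ge> 4" using nondegenerate_card_ge[OF V G(1) _ G(3)] G(2) by (simp add: g_def X_def)
  have G': "subspace G" "dim G = s" using G(1) by (auto simp: nondegenerate_def)
  have span_G: "span {p, q} \<subseteq> G" if "p \<in> X" "q \<in> X" for p q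
    using that G' by (intro span_minimal) (auto simp: X_def)
  have "real (card (X \<inter> span {p, q})) \<le> \<delta> * real (card X)" if pq: "p \<in> X" "q \<in> X" "p \<noteq> q" for p q
  proof -
    \<comment> \<open>Since \<open>s \<ge> 3\<close>, this span is a proper subspace of
      \<open>G\<close>, so nondegeneracy limits its points.\<close>
    have "dim (span {p, q}) = 2"
      using dim_eq_card_independent[OF projective_independent[OF X pq]] pq by simp
    then have "real (card (V \<inter> span {p, q})) \<le> \<delta> * real (card (V \<inter> G))"
      using G(1,2) span_G[OF pq(1,2)] by (simp add: nondegenerate_def)
    moreover have "X \<inter> span {p, q} = V \<inter> span {p, q}" using span_G[OF pq(1,2)] by (auto simp: X_def)
    ultimately show ?thesis by (simp add: X_def)
  qed
  then have "real (card (SIGMA p:X. hv p)) \<le> 2304 * (1 / real B + \<delta>) * g ^ 2"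
    unfolding g_def hv_def using X B \<delta>(1) by (intro heavy_pairs_bound) auto
  also have "\<dots> \<le> 1 / 16 * g ^ 2" using \<delta>(3) by (intro mult_right_mono) auto
  finally have "real (card (SIGMA p:X. hv p)) \<le> g ^ 2 / 16" by simp
  moreover have "card (SIGMA p:X. hv p) = (\<Sum>p\<in>X. card (hv p))"
    using finX by (intro card_SigmaI) (auto simp: hv_def)
  moreover have "g / 4 * real (card Bad) \<le> (\<Sum>p\<in>Bad. real (card (hv p)))"
    using sum_mono[of Bad "\<lambda>_. g / 4" "\<lambda>p. real (card (hv p))"] by (simp add: Bad_def mult.commute)
  moreover have "(\<Sum>p\<in>Bad. real (card (hv p))) \<le> (\<Sum>p\<in>X. real (card (hv p)))"
    using finX by (intro sum_mono2) (auto simp: Bad_def)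
  ultimately have "g / 4 * real (card Bad) \<le> g ^ 2 / 16" by simp
  then have "g * (4 * real (card Bad)) \<le> g * g" by (simp add: power2_eq_square)
  then have bad: "4 * real (card Bad) \<le> g" using g4 by simp
  have "X - Bad \<subseteq> good_points B V G"
  proof
    fix p assume p: "p \<in> X - Bad"
    have eq: "light (real B) V p \<inter> G = X - {p} - hv p"
    proof -
      have "X \<inter> span {p, q} = V \<inter> span {p, q}" if "q \<in> X" for q using span_G[of p q] p that by (auto simp: X_def)
      then show ?thesis by (auto simp: light_def hv_def X_def)
    qed
    have "card X \<le> card ((X - {p} - hv p) \<union> ({p} \<union> hv p))"
      using finX by (intro card_mono) (auto simp: hv_def)
    also have "\<dots> \<le> card (X - {p} - hv p) + card ({p} \<union> hv p)" by (rule card_Un_le)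
    also have "card ({p} \<union> hv p) \<le> card {p} + card (hv p)" by (rule card_Un_le)
    finally have "card X \<le> card (X - {p} - hv p) + (1 + card (hv p))" by simp
    moreover have "real (card (hv p)) \<le> g / 4" using p by (auto simp: Bad_def)
    ultimately have "g / 2 \<le> real (card (X - {p} - hv p))" using g4 unfolding g_def by linarith
    then have "g / 2 \<le> real (card (light (real B) V p \<inter> G))" by (simp only: eq)
    then show "p \<in> good_points B V G" using p by (auto simp: good_points_def g_def X_def)
  qed
  then have "card (X - Bad) \<le> card (good_points B V G)"
    using finX by (intro card_mono finite_subset[of "good_points B V G" X]) (auto simp: good_points_def X_def)
  moreover have "card X \<le> card (X - Bad) + card Bad"
    using diff_card_le_card_Diff[of Bad X] finX by (simp add: Bad_def)
  ultimately have "g / 2 \<le> real (card (good_points B V G))" using bad unfolding g_def by linarith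
  then show ?thesis by (simp add: g_def X_def)
qed

text \<open>The \<open>itself\<close> argument fixes the ambient space, which the other parameters
  do not mention. A real \<open>k\<close> allows the richness to be rescaled when
  projecting.\<close>

definition few_rich_flats :: "'a::euclidean_space itself \<Rightarrow> nat \<Rightarrow> real \<Rightarrow> real \<Rightarrow> bool" where
  "few_rich_flats T s \<delta> K \<longleftrightarrow> (\<forall>(V :: 'a set) k. projective_set V \<longrightarrow> k > 0 \<longrightarrow>
     real (card {G. nondegenerate \<delta> s V G \<and> k \<le> real (card (V \<inter> G))})
       \<le> K * (real (card V) ^ s / k ^ (s + 1) + real (card V) ^ (s - 1) / k ^ (s - 1)))"

text \<open>A one-dimensional subspace contains at most one vector of \<open>V\<close>, so nothing
  is counted unless \<open>k \<le> 1\<close>.\<close>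

lemma few_rich_flats_1: "few_rich_flats TYPE('a::euclidean_space) 1 (1/2) 1"
  unfolding few_rich_flats_def
proof (intro allI impI)
  fix V :: "'a set" and k :: real assume V: "projective_set V" and k: "k > 0"
  note Vd = projective_setD[OF V]
  let ?\<G> = "{G. nondegenerate (1/2) 1 V G \<and> k \<le> real (card (V \<inter> G))}"
  have G: "\<exists>v\<in>V. G = span {v} \<and> k \<le> 1" if G: "G \<in> ?\<G>" for G
  proof -
    have "card (V \<inter> G) > 0" using that k by (auto intro: gr0I)
    then obtain v where v: "v \<in> V" "v \<in> G" by (metis IntE card_gt_0_iff ex_in_conv)
    have "v \<noteq> 0" using Vd(2) v by blast
    then have eq: "span {v} = G" using G v
      by (intro subspace_dim_equal span_minimal) (auto simp: nondegenerate_def)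
    moreover have "V \<inter> span {v} = {v}" using Vd(3)[of v] v by (auto simp: span_base)
    ultimately have "k \<le> 1" using G by auto
    then show ?thesis using v eq by blast
  qed
  have "real (card ?\<G>) \<le> real (card V) / k ^ 2"
  proof (cases "k \<le> 1")
    case True
    have "?\<G> \<subseteq> (\<lambda>v. span {v}) ` V" using G by blast
    then have "card ?\<G> \<le> card V" using Vd(1) by (meson card_image_le card_mono finite_imageI le_trans)
    also have "real (card V) \<le> real (card V) / k ^ 2"
      using True k by (simp add: le_divide_eq power_le_one mult_left_le)
    finally show ?thesis by simp
  next
    case False
    then have empty: "?\<G> = {}" using G by blast
    show ?thesis unfolding empty by simp
  qed
  then show "real (card ?\<G>) \<le> 1 * (real (card V) ^ 1 / k ^ (1 + 1) + real (card V) ^ (1 - 1) / k ^ (1 - 1))"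
    by (simp add: power2_eq_square)
qed

text \<open>With proportion 1/2 a counted subspace has at least two points, so \<open>k\<close> may
  be raised to \<open>max k 2\<close>, where the planar bound applies.\<close>

lemma few_rich_flats_2: "few_rich_flats TYPE('a::euclidean_space) 2 (1/2) 576"
  unfolding few_rich_flats_def
proof (intro allI impI)
  fix V :: "'a set" and k :: real assume V: "projective_set V" and k: "k > 0"
  let ?\<G> = "{G. nondegenerate (1/2) 2 V G \<and> k \<le> real (card (V \<inter> G))}"
  let ?k = "max k 2"
  have "real (card ?\<G>) \<le> 576 * (real (card V) ^ 2 / ?k ^ 3 + real (card V) / ?k)"
  proof (intro szemeredi_trotter_projective[OF V, THEN conjunct2])
    fix G assume G: "G \<in> ?\<G>"
    then have "card (V \<inter> G) > 0" using k by (auto intro: gr0I)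
    then have "1 \<le> 1 / 2 * real (card (V \<inter> G))" using G by (intro nondegenerate_card_ge[OF V]) auto
    then show "subspace G \<and> dim G = 2 \<and> ?k \<le> real (card (V \<inter> G))" using G by (auto simp: nondegenerate_def)
  qed simp
  also have "\<dots> \<le> 576 * (real (card V) ^ 2 / k ^ 3 + real (card V) / k)"
    using k by (intro mult_left_mono add_mono divide_left_mono power_mono) auto
  finally show "real (card ?\<G>) \<le> 576 * (real (card V) ^ 2 / k ^ (2 + 1) + real (card V) ^ (2 - 1) / k ^ (2 - 1))"
    by (simp add: eval_nat_numeral)
qed

text \<open>Count pairs of a rich flat and a good point of it. Each flat has at least
  \<open>k / 2\<close> good points. For a fixed point, \<open>link\<close> maps its flats
  injectively to nondegenerate flats of dimension \<open>s\<close> with richness at least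
  \<open>k / (2 * B)\<close>. Summing the induction bound over n points and dividing by
  \<open>k / 2\<close> multiplies both terms by n/k, up to constants.\<close>

lemma few_rich_flats_Suc:
  assumes IH: "few_rich_flats TYPE('a::euclidean_space) s \<delta>' K'" and s: "s \<ge> 2"
    and \<delta>': "0 < \<delta>'" "\<delta>' < 1" and K': "K' \<ge> 0"
  defines "B \<equiv> 73728 :: nat"
  shows "few_rich_flats TYPE('a) (Suc s) (\<delta>' / (2 * real B)) (2 * K' * (2 * real B) ^ (s + 1))"
  unfolding few_rich_flats_def
proof (intro allI impI)
  fix V :: "'a set" and k :: real assume V: "projective_set V" and k: "k > 0"
  note Vd = projective_setD[OF V]
  define \<delta> where "\<delta> = \<delta>' / (2 * real B)"
  define n where "n = real (card V)"
  define b where "b = 2 * real B"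
  define \<G> where "\<G> = {G. nondegenerate \<delta> (Suc s) V G \<and> k \<le> real (card (V \<inter> G))}"
  \<comment> \<open>\<open>2304 / B = 1 / 32\<close> and \<open>2304 * \<delta> < 1 / 64\<close>,
    which together stay below 1/16.\<close>
  have \<delta>: "0 < \<delta>" "\<delta> \<le> 1 / 4" "2304 * (1 / real B + \<delta>) \<le> 1 / 16" "\<delta> < 1"
    using \<delta>' by (auto simp: \<delta>_def B_def)
  have b: "b \<ge> 1" by (simp add: b_def B_def)
  have n0: "n \<ge> 0" by (simp add: n_def)
  have pos: "card (V \<inter> G) > 0" if "G \<in> \<G>" for G using that k by (auto simp: \<G>_def intro: gr0I)
  have fin: "finite \<G>"
    by (rule finite_subset[OF _ finite_nondegenerate[OF Vd(1) \<delta>(4), of "Suc s"]]) (use pos in \<open>auto simp: \<G>_def\<close>)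
  define R where "R = K' * (n ^ s / (k / b) ^ (s + 1) + n ^ (s - 1) / (k / b) ^ (s - 1))"
  have per_point: "real (card {G \<in> \<G>. p \<in> good_points B V G}) \<le> R" if p: "p \<in> V" for p
  proof -
    have p0: "p \<noteq> 0" using Vd(2) p by blast
    obtain V' where V': "projective_set V'" "card V' \<le> card V"
      and cnt: "\<And>G. subspace G \<Longrightarrow> p \<in> G \<Longrightarrow> real (card (light (real B) V p \<inter> G)) \<le> real B * real (card (V' \<inter> link p G))"
      and sub: "\<And>G W'. subspace G \<Longrightarrow> p \<in> G \<Longrightarrow> subspace W' \<Longrightarrow> W' \<subseteq> link p G \<Longrightarrow>
        \<exists>W. subspace W \<and> W \<subseteq> G \<and> dim W = dim W' + 1 \<and> card (V' \<inter> W') \<le> card (V \<inter> W)"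
      using projection_from_point[OF V p, of "real B"] by auto
    let ?\<G>' = "{G'. nondegenerate \<delta>' s V' G' \<and> k / b \<le> real (card (V' \<inter> G'))}"
    have "link p G \<in> ?\<G>'" if G: "G \<in> \<G>" "p \<in> good_points B V G" for G
    proof -
      have Gs: "subspace G" "dim G = Suc s" "p \<in> G" "k \<le> real (card (V \<inter> G))"
        using G by (auto simp: \<G>_def nondegenerate_def good_points_def)
      have "real (card (V \<inter> G)) / 2 \<le> real B * real (card (V' \<inter> link p G))"
        using cnt[OF Gs(1,3)] G(2) by (auto simp: good_points_def)
      then have big: "real (card (V \<inter> G)) \<le> b * real (card (V' \<inter> link p G))" by (simp add: b_def)
      \<comment> \<open>Projection costs a factor 2 for restricting to light lines and a factor
        \<open>B\<close> for multiplicities; \<open>\<delta>\<close> is smaller than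
        \<open>\<delta>'\<close> by exactly \<open>2 * B\<close>, so nondegeneracy descends to the
        link.\<close>
      have "real (card (V' \<inter> W')) \<le> \<delta>' * real (card (V' \<inter> link p G))"
        if W': "subspace W'" "W' \<subseteq> link p G" "dim W' < s" for W'
      proof -
        obtain W where W: "subspace W" "W \<subseteq> G" "dim W = dim W' + 1" "card (V' \<inter> W') \<le> card (V \<inter> W)"
          using sub[OF Gs(1,3) W'(1,2)] by blast
        have "real (card (V' \<inter> W')) \<le> real (card (V \<inter> W))" using W(4) by simp
        also have "\<dots> \<le> \<delta> * real (card (V \<inter> G))" using G(1) W W'(3) by (auto simp: \<G>_def nondegenerate_def)
        also have "\<dots> \<le> \<delta> * (b * real (card (V' \<inter> link p G)))" using big \<delta>(1) by (intro mult_left_mono) auto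
        also have "\<dots> = \<delta>' * real (card (V' \<inter> link p G))" by (simp add: \<delta>_def b_def B_def)
        finally show ?thesis .
      qed
      moreover have "dim (link p G) = s" using dim_link[OF Gs(1,3) p0] Gs(2) by simp
      moreover have "k / b \<le> real (card (V' \<inter> link p G))" using big Gs(4) b by (simp add: divide_le_eq mult.commute)
      ultimately show ?thesis using subspace_link[OF Gs(1)] by (auto simp: nondegenerate_def)
    qed
    moreover have "inj_on (link p) {G \<in> \<G>. p \<in> good_points B V G}"
      by (rule inj_on_subset[OF inj_on_link[OF p0]]) (auto simp: \<G>_def nondegenerate_def good_points_def)
    moreover have "finite ?\<G>'"
    proof (rule finite_subset[OF _ finite_nondegenerate[OF projective_setD(1)[OF V'(1)] \<delta>'(2), of s]])
      have "k / b > 0" using k b by simp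
      then show "?\<G>' \<subseteq> {G. nondegenerate \<delta>' s V' G \<and> card (V' \<inter> G) > 0}" by (auto intro!: gr0I)
    qed
    ultimately have "card {G \<in> \<G>. p \<in> good_points B V G} \<le> card ?\<G>'"
      by (intro card_inj_on_le[of "link p"]) auto
    also have "real (card ?\<G>') \<le> K' * (real (card V') ^ s / (k / b) ^ (s + 1) + real (card V') ^ (s - 1) / (k / b) ^ (s - 1))"
      using k b by (intro IH[unfolded few_rich_flats_def, rule_format] V'(1)) auto
    also have "\<dots> \<le> R" unfolding R_def n_def
      using V'(2) k b K' by (intro mult_left_mono add_mono divide_right_mono power_mono) auto
    finally show ?thesis by simp
  qed
  have "k / 2 * real (card \<G>) = (\<Sum>G\<in>\<G>. k / 2)" by simp
  also have "\<dots> \<le> (\<Sum>G\<in>\<G>. real (card {p \<in> V. p \<in> good_points B V G}))"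
  proof (rule sum_mono)
    fix G assume G: "G \<in> \<G>"
    have "real (card (V \<inter> G)) / 2 \<le> real (card (good_points B V G))"
      using G pos[OF G] \<delta> s by (intro many_good_points[OF V, of \<delta> "Suc s"]) (auto simp: \<G>_def B_def)
    moreover have "{p \<in> V. p \<in> good_points B V G} = good_points B V G" by (auto simp: good_points_def)
    ultimately show "k / 2 \<le> real (card {p \<in> V. p \<in> good_points B V G})" using G by (auto simp: \<G>_def)
  qed
  also have "\<dots> = (\<Sum>p\<in>V. real (card {G \<in> \<G>. p \<in> good_points B V G}))"
    using sum_multicount_gen[OF fin Vd(1), of "\<lambda>G p. p \<in> good_points B V G"]
    by (simp flip: of_nat_sum)
  also have "\<dots> \<le> (\<Sum>p\<in>V. R)" by (rule sum_mono, rule per_point)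
  also have "\<dots> = n * R" by (simp add: n_def)
  finally have main: "real (card \<G>) \<le> 2 / k * (n * R)" using k by (simp add: field_simps)
  obtain t where t: "s = Suc t" using s by (cases s) auto
  have "2 / k * (n * R) = 2 * K' * (b ^ (s + 1) * (n ^ Suc s / k ^ (s + 2)) + b ^ (s - 1) * (n ^ s / k ^ s))"
    using k b by (simp add: R_def t power_divide field_simps)
  also have "\<dots>
      \<le> 2 * K' * (b ^ (s + 1) * (n ^ Suc s / k ^ (s + 2)) + b ^ (s + 1) * (n ^ s / k ^ s))"
    using b k n0 K' by (intro mult_left_mono add_mono mult_right_mono power_increasing) auto
  also have "\<dots> = 2 * K' * b ^ (s + 1) * (n ^ Suc s / k ^ (Suc s + 1) + n ^ (Suc s - 1) / k ^ (Suc s - 1))"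
    by (simp add: algebra_simps)
  finally have "real (card \<G>) \<le> 2 * K' * b ^ (s + 1) * (n ^ Suc s / k ^ (Suc s + 1) + n ^ (Suc s - 1) / k ^ (Suc s - 1))"
    by (rule order_trans[OF main])
  then show "real (card {G. nondegenerate (\<delta>' / (2 * real B)) (Suc s) V G \<and> k \<le> real (card (V \<inter> G))})
      \<le> 2 * K' * (2 * real B) ^ (s + 1) * (real (card V) ^ Suc s / k ^ (Suc s + 1) + real (card V) ^ (Suc s - 1) / k ^ (Suc s - 1))"
    by (simp only: \<G>_def \<delta>_def n_def b_def)
qed

theorem ex_few_rich_flats:
  assumes "s \<ge> 1"
  shows "\<exists>\<delta> K. 0 < \<delta> \<and> \<delta> < 1 \<and> 0 \<le> K \<and> few_rich_flats TYPE('a::euclidean_space) s \<delta> K"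
proof (cases "s = 1")
  case True
  then show ?thesis using few_rich_flats_1 by (intro exI[of _ "1/2"] exI[of _ 1]) auto
next
  case False
  with assms have "2 \<le> s" by simp
  then show ?thesis
  proof (induction s rule: dec_induct)
    case base
    show ?case using few_rich_flats_2 by (intro exI[of _ "1/2"] exI[of _ 576]) auto
  next
    case (step s)
    then obtain \<delta> K where *: "0 < \<delta>" "\<delta> < 1" "0 \<le> K" "few_rich_flats TYPE('a) s \<delta> K" by blast
    have "0 < \<delta> / (2 * real 73728)" "\<delta> / (2 * real 73728) < 1" "0 \<le> 2 * K * (2 * real 73728) ^ (s + 1)"
      using *(1-3) by auto
    then show ?case using few_rich_flats_Suc[OF *(4) step(1) *(1-3)] by blast
  qed
qed

section \<open>Counting dependent sets\<close>

text \<open>Allows additive constants to be absorbed into multiples of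
  \<open>ln (real l)\<close>.\<close>

lemma ln_ge_half: "2 \<le> l \<Longrightarrow> 1 / 2 \<le> ln (real l)"
proof -
  assume l: "2 \<le> l"
  have "ln (exp (1 / 2)) \<le> ln (real l)"
    using l exp_half_le2 by (subst ln_le_cancel_iff) auto
  then show ?thesis by simp
qed

lemma harmonic_sum_le:
  assumes "l \<ge> 1"
  shows "(\<Sum>a=1..l. 1 / real a) \<le> 1 + ln (real l)"
  using assms
proof (induction l rule: dec_induct)
  case (step l)
  have "ln (real l / real (Suc l)) \<le> real l / real (Suc l) - 1"
    using step by (intro ln_le_minus_one) auto
  also have "\<dots> = - 1 / real (Suc l)" by (simp add: field_simps)
  finally have "1 / real (Suc l) \<le> ln (real (Suc l)) - ln (real l)"
    using step by (simp add: ln_div)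
  then show ?case using step by simp
qed simp

text \<open>The level weight \<open>a ^ s\<close> turns the two terms of the richness bound into
  \<open>n ^ s / a\<close> and \<open>n ^ (s - 1) * a\<close>. The harmonic sum is at most
  \<open>3 * ln l\<close> because \<open>1 \<le> 2 * ln l\<close>; the second sum is at most
  \<open>l ^ 2 \<le> C ^ 2 * n\<close>, which is where the square-root bound on \<open>l\<close>
  enters.\<close>

lemma sum_nondegenerate_powers:
  fixes V :: "'a::euclidean_space set"
  assumes few: "few_rich_flats TYPE('a) s \<delta> K" and s: "s \<ge> 1" and \<delta>: "\<delta> < 1" and K: "K \<ge> 0"
    and V: "projective_set V" and l: "2 \<le> l" "real l \<le> C * sqrt (real (card V))"
  shows "(\<Sum>G | nondegenerate \<delta> s V G \<and> 0 < card (V \<inter> G) \<and> card (V \<inter> G) \<le> l. real (card (V \<inter> G)) ^ Suc s)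
    \<le> real (Suc s) * K * (3 + 2 * C ^ 2) * real (card V) ^ s * ln (real l)"
proof -
  define n where "n = real (card V)"
  define \<G> where "\<G> = {G. nondegenerate \<delta> s V G \<and> 0 < card (V \<inter> G) \<and> card (V \<inter> G) \<le> l}"
  have n0: "n \<ge> 0" by (simp add: n_def)
  have fin0: "finite {G. nondegenerate \<delta> s V G \<and> 0 < card (V \<inter> G)}"
    using finite_nondegenerate[OF projective_setD(1)[OF V] \<delta>] .
  then have fin: "finite \<G>" by (rule rev_finite_subset) (auto simp: \<G>_def)
  obtain t where t: "s = Suc t" using s by (cases s) auto
  have "(\<Sum>G\<in>\<G>. real (card (V \<inter> G)) ^ Suc s)
      \<le> (\<Sum>a=1..l. real (Suc s) * real a ^ s * real (card {G \<in> \<G>. a \<le> card (V \<inter> G)}))"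
    by (rule sum_power_le_rich[OF fin]) (simp add: \<G>_def)
  also have "\<dots> \<le> (\<Sum>a=1..l. real (Suc s) * K * (n ^ s * (1 / real a) + n ^ (s - 1) * real a))"
  proof (rule sum_mono)
    fix a assume a: "a \<in> {1..l}"
    have "card {G \<in> \<G>. a \<le> card (V \<inter> G)} \<le> card {G. nondegenerate \<delta> s V G \<and> real a \<le> real (card (V \<inter> G))}"
      using a by (intro card_mono finite_subset[OF _ fin0]) (auto simp: \<G>_def)
    also have "real \<dots> \<le> K * (n ^ s / real a ^ (s + 1) + n ^ (s - 1) / real a ^ (s - 1))"
      unfolding n_def using a by (intro few[unfolded few_rich_flats_def, rule_format] V) auto
    finally have "real (Suc s) * real a ^ s * real (card {G \<in> \<G>. a \<le> card (V \<inter> G)})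
        \<le> real (Suc s) * real a ^ s * (K * (n ^ s / real a ^ (s + 1) + n ^ (s - 1) / real a ^ (s - 1)))"
      by (intro mult_left_mono) auto
    also have "\<dots> = real (Suc s) * K * (n ^ s * (1 / real a) + n ^ (s - 1) * real a)"
      using a by (simp add: t field_simps)
    finally show "real (Suc s) * real a ^ s * real (card {G \<in> \<G>. a \<le> card (V \<inter> G)})
        \<le> real (Suc s) * K * (n ^ s * (1 / real a) + n ^ (s - 1) * real a)" .
  qed
  also have "\<dots> = real (Suc s) * K * (n ^ s * (\<Sum>a=1..l. 1 / real a) + n ^ (s - 1) * (\<Sum>a=1..l. real a))"
    by (simp add: sum.distrib sum_distrib_left distrib_left)
  also have "\<dots> \<le> real (Suc s) * K * (n ^ s * (3 * ln (real l)) + n ^ (s - 1) * (2 * C ^ 2 * n * ln (real l)))"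
  proof (intro mult_left_mono add_mono)
    show "(\<Sum>a=1..l. 1 / real a) \<le> 3 * ln (real l)"
      using harmonic_sum_le[of l] ln_ge_half[OF l(1)] l(1) by simp
    have "(\<Sum>a=1..l. real a) \<le> (\<Sum>a=1..l. real l)" by (intro sum_mono) auto
    also have "\<dots> = real l ^ 2" by (simp add: power2_eq_square)
    also have "\<dots> \<le> (C * sqrt n) ^ 2" using l(2) by (intro power_mono) (auto simp: n_def)
    also have "\<dots> = C ^ 2 * n * 1" using n0 by (simp add: power_mult_distrib)
    also have "\<dots> \<le> C ^ 2 * n * (2 * ln (real l))"
      using ln_ge_half[OF l(1)] n0 by (intro mult_left_mono) auto
    finally show "(\<Sum>a=1..l. real a) \<le> 2 * C ^ 2 * n * ln (real l)" by simp
  qed (use n0 K in auto)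
  also have "\<dots> = real (Suc s) * K * (3 + 2 * C ^ 2) * n ^ s * ln (real l)"
    by (simp add: t algebra_simps)
  finally show ?thesis by (simp add: \<G>_def n_def)
qed

text \<open>As long as the flat is degenerate, pass to a proper subspace keeping a proportion at
  least \<open>\<epsilon>\<close> of its points. The dimension drops each time, and it cannot reach
  0 because points remain.\<close>

lemma ex_nondegenerate_subflat:
  fixes V :: "'a::euclidean_space set"
  assumes V: "projective_set V" and \<epsilon>: "0 < \<epsilon>" "\<epsilon> < 1" and \<delta>: "\<And>s. 1 \<le> s \<Longrightarrow> s \<le> d \<Longrightarrow> \<epsilon> \<le> \<delta> s"
    and F: "subspace F" "dim F \<le> d" "0 < card (V \<inter> F)"
  shows "\<exists>s G. 1 \<le> s \<and> s \<le> dim F \<and> G \<subseteq> F \<and> nondegenerate (\<delta> s) s V G \<and>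
    \<epsilon> ^ dim F * real (card (V \<inter> F)) \<le> real (card (V \<inter> G))"
  using F
proof (induction "dim F" arbitrary: F rule: less_induct)
  case less
  obtain v where v: "v \<in> V" "v \<in> F" using less.prems(3) by (metis IntE card_gt_0_iff ex_in_conv)
  then have "v \<noteq> 0" using projective_setD(2)[OF V] by blast
  then have "\<not> F \<subseteq> {0}" using v by blast
  then have r: "1 \<le> dim F" using dim_eq_0[of F] by linarith
  show ?case
  proof (cases "nondegenerate (\<delta> (dim F)) (dim F) V F")
    case True
    have "\<epsilon> ^ dim F * real (card (V \<inter> F)) \<le> 1 * real (card (V \<inter> F))"
      using \<epsilon> by (intro mult_right_mono power_le_one) auto
    then show ?thesis using True r by (intro exI[of _ "dim F"] exI[of _ F]) auto
  next
    case False
    then obtain W where W: "subspace W" "W \<subseteq> F" "dim W < dim F"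
      "\<delta> (dim F) * real (card (V \<inter> F)) < real (card (V \<inter> W))"
      using less.prems(1) by (auto simp: nondegenerate_def not_le)
    have "\<epsilon> * real (card (V \<inter> F)) \<le> \<delta> (dim F) * real (card (V \<inter> F))"
      using \<delta>[OF r less.prems(2)] by (intro mult_right_mono) auto
    then have \<epsilon>W: "\<epsilon> * real (card (V \<inter> F)) \<le> real (card (V \<inter> W))" using W(4) by linarith
    moreover have "0 < \<epsilon> * real (card (V \<inter> F))" using \<epsilon> less.prems(3) by simp
    ultimately have "0 < card (V \<inter> W)" by linarith
    then obtain s G where G: "1 \<le> s" "s \<le> dim W" "G \<subseteq> W" "nondegenerate (\<delta> s) s V G"
      "\<epsilon> ^ dim W * real (card (V \<inter> W)) \<le> real (card (V \<inter> G))"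
      using less.hyps[OF W(3,1)] W less.prems(2) by auto
    have "\<epsilon> ^ dim F * real (card (V \<inter> F)) \<le> \<epsilon> ^ Suc (dim W) * real (card (V \<inter> F))"
      using \<epsilon> W(3) by (intro mult_right_mono power_decreasing) auto
    also have "\<dots> = \<epsilon> ^ dim W * (\<epsilon> * real (card (V \<inter> F)))" by simp
    also have "\<dots> \<le> \<epsilon> ^ dim W * real (card (V \<inter> W))" using \<epsilon>W \<epsilon> by (intro mult_left_mono) auto
    finally show ?thesis using G W by (intro exI[of _ s] exI[of _ G]) auto
  qed
qed

section \<open>Encoding dependent sets by nondegenerate flats\<close>

lemma card_subsets_le_power:
  assumes "finite A"
  shows "card {Z. Z \<subseteq> A \<and> card Z = k} \<le> card A ^ k"
  using n_subsets[OF assms, of k] binomial_le_pow[of k "card A"]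
  by (cases "k \<le> card A") (auto simp: binomial_eq_0)

text \<open>Extend a basis of \<open>G\<close> to one of the span using elements of
  \<open>D\<close>. At most \<open>d - dim G\<close> are needed; padding to exactly that many fixes
  the size of the rest of \<open>D\<close>.\<close>

lemma ex_spanning_extension:
  fixes D :: "'a::euclidean_space set"
  assumes G: "subspace G" "G \<subseteq> span D" "dim D \<le> d" and D: "card D = d + 1"
  shows "\<exists>Y\<subseteq>D. card Y = d - dim G \<and> D \<subseteq> span (G \<union> Y)"
proof -
  have finD: "finite D" using D by (metis Suc_eq_plus1 card.infinite nat.distinct(1))
  obtain A where A: "A \<subseteq> G" "independent A" "G \<subseteq> span A" "card A = dim G" using basis_exists by blast
  obtain B where B: "A \<subseteq> B" "B \<subseteq> A \<union> D" "independent B" "A \<union> D \<subseteq> span B"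
    using maximal_independent_subset_extend[of A "A \<union> D"] A(2) by blast
  have finB: "finite B" using B(3) by (rule independent_imp_finite)
  have "B \<subseteq> span D" using B(2) A(1) G(2) span_superset by blast
  then have "card B \<le> dim D" using B(3) independent_card_le_dim[of B "span D"] by simp
  then have "card (B - A) \<le> d - dim G" using A(4) B(1) finB G(3) by (simp add: card_Diff_subset finite_subset)
  moreover have "B - A \<subseteq> D" using B(2) by blast
  moreover have "d - dim G \<le> card D" using D by simp
  ultimately obtain Y where Y: "B - A \<subseteq> Y" "Y \<subseteq> D" "card Y = d - dim G"
    using exists_subset_between finD by metis
  have "B \<subseteq> G \<union> Y" using Y(1) A(1) by blast
  then have "D \<subseteq> span (G \<union> Y)" using B(4) span_mono by blast
  then show ?thesis using Y by blast
qed

text \<open>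
  A dependent set \<open>D\<close> is encoded by a nondegenerate \<open>G \<subseteq> span D\<close> of dimension \<open>s\<close> with a proportion at least
  \<open>\<gamma>\<close> of the points of \<open>span D\<close>, a \<open>(d - s)\<close>-subset \<open>Y\<close> with \<open>D \<subseteq> span (G \<union> Y)\<close>, and \<open>D - Y\<close>. The last has \<open>s + 1\<close>
  elements, each chosen among at most \<open>card (V \<inter> G) / \<gamma>\<close> points.
\<close>

theorem dependent_sets_bound:
  fixes C :: real and d :: nat
  shows "\<exists>K\<ge>1. \<forall>(V :: 'a::euclidean_space set) l. projective_set V \<longrightarrow> 2 \<le> l \<longrightarrow> real l \<le> C * sqrt (real (card V)) \<longrightarrow>
    real (card {D. D \<subseteq> V \<and> card D = d + 1 \<and> dim D \<le> d \<and> card (V \<inter> span D) \<le> l}) \<le> K * real (card V) ^ d * ln (real l)"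
proof -
  obtain \<delta> K where \<delta>K: "\<And>s. 1 \<le> s \<Longrightarrow> 0 < \<delta> s \<and> \<delta> s < 1 \<and> 0 \<le> K s \<and> few_rich_flats TYPE('a) s (\<delta> s) (K s)"
    using ex_few_rich_flats[where 'a = 'a] by metis
  \<comment> \<open>Inserting 1/2 keeps the set nonempty and \<open>\<epsilon>\<close> below 1 even
    for \<open>d = 0\<close>.\<close>
  define \<epsilon> where "\<epsilon> = Min (insert (1/2) (\<delta> ` {1..d}))"
  have \<epsilon>: "0 < \<epsilon>" "\<epsilon> < 1" using \<delta>K by (auto simp: \<epsilon>_def Min_gr_iff Min_less_iff)
  have \<epsilon>\<delta>: "\<epsilon> \<le> \<delta> s" if "1 \<le> s" "s \<le> d" for s unfolding \<epsilon>_def using that by (intro Min_le) auto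
  define \<gamma> where "\<gamma> = \<epsilon> ^ d"
  have \<gamma>: "0 < \<gamma>" using \<epsilon> by (simp add: \<gamma>_def)
  define A where "A = (\<lambda>s. (1 / \<gamma>) ^ Suc s * (real (Suc s) * K s * (3 + 2 * C ^ 2)))"
  have A0: "A s \<ge> 0" if "s \<in> {1..d}" for s using \<delta>K[of s] \<gamma> that by (auto simp: A_def)
  show ?thesis
  \<comment> \<open>The summand 1 only secures a constant of at least 1, which later keeps the
    sampling probability at most 1.\<close>
  proof (intro exI[of _ "1 + (\<Sum>s=1..d. A s)"] conjI allI impI)
    show "1 \<le> 1 + (\<Sum>s=1..d. A s)" using sum_nonneg[of "{1..d}" A] A0 by simp
    fix V :: "'a set" and l :: nat
    assume V: "projective_set V" and l: "2 \<le> l" "real l \<le> C * sqrt (real (card V))"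
    note Vd = projective_setD[OF V]
    define n where "n = real (card V)"
    define \<D> where "\<D> = {D. D \<subseteq> V \<and> card D = d + 1 \<and> dim D \<le> d \<and> card (V \<inter> span D) \<le> l}"
    define \<G> where "\<G> = (\<lambda>s. {G. nondegenerate (\<delta> s) s V G \<and> 0 < card (V \<inter> G) \<and> card (V \<inter> G) \<le> l})"
    \<comment> \<open>The size condition is phrased through \<open>G\<close> and \<open>Y\<close>
      alone, so that the choices for \<open>\<Z>\<close> can be counted without knowing
      \<open>D\<close>.\<close>
    define \<Y> where "\<Y> = (\<lambda>s G. {Y. Y \<subseteq> V \<and> card Y = d - s \<and> real (card (V \<inter> span (G \<union> Y))) \<le> real (card (V \<inter> G)) / \<gamma>})"
    define \<Z> where "\<Z> = (\<lambda>s G Y. {Z. Z \<subseteq> V \<inter> span (G \<union> Y) \<and> card Z = Suc s})"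
    have fin\<G>: "finite (\<G> s)" if "1 \<le> s" for s
      by (rule finite_subset[OF _ finite_nondegenerate[OF Vd(1), of "\<delta> s" s]]) (use \<delta>K[OF that] in \<open>auto simp: \<G>_def\<close>)
    have fin\<Y>: "finite (\<Y> s G)" for s G by (rule finite_subset[of _ "Pow V"]) (use Vd(1) in \<open>auto simp: \<Y>_def\<close>)
    have fin\<Z>: "finite (\<Z> s G Y)" for s G Y by (rule finite_subset[of _ "Pow V"]) (use Vd(1) in \<open>auto simp: \<Z>_def\<close>)
    have "\<D> \<subseteq> (\<Union>s\<in>{1..d}. \<Union>G\<in>\<G> s. \<Union>Y\<in>\<Y> s G. (\<union>) Y ` \<Z> s G Y)"
    proof
      fix D assume "D \<in> \<D>"
      then have D: "D \<subseteq> V" "card D = d + 1" "dim D \<le> d" "card (V \<inter> span D) \<le> l" by (auto simp: \<D>_def)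
      have "D \<subseteq> V \<inter> span D" using D(1) by (auto simp: span_base)
      then have pos: "0 < card (V \<inter> span D)" using D(2) Vd(1) by (metis add_gr_0 card_mono finite_Int less_le_trans zero_less_one)
      have "\<exists>s G. 1 \<le> s \<and> s \<le> dim (span D) \<and> G \<subseteq> span D \<and> nondegenerate (\<delta> s) s V G \<and>
          \<epsilon> ^ dim (span D) * real (card (V \<inter> span D)) \<le> real (card (V \<inter> G))"
      proof (rule ex_nondegenerate_subflat[OF V \<epsilon>])
        show "\<epsilon> \<le> \<delta> s" if "1 \<le> s" "s \<le> d" for s using \<epsilon>\<delta> that .
      qed (use D(3) pos in auto)
      then obtain s G where G: "1 \<le> s" "s \<le> dim (span D)" "G \<subseteq> span D" "nondegenerate (\<delta> s) s V G"
        "\<epsilon> ^ dim (span D) * real (card (V \<inter> span D)) \<le> real (card (V \<inter> G))"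
        by blast
      have "\<gamma> * real (card (V \<inter> span D)) \<le> \<epsilon> ^ dim (span D) * real (card (V \<inter> span D))"
        unfolding \<gamma>_def using \<epsilon> D(3) by (intro mult_right_mono power_decreasing) auto
      then have \<gamma>G: "\<gamma> * real (card (V \<inter> span D)) \<le> real (card (V \<inter> G))" using G(5) by linarith
      have "0 < \<gamma> * real (card (V \<inter> span D))" using pos \<gamma> by simp
      then have "0 < card (V \<inter> G)" using \<gamma>G by linarith
      moreover have "card (V \<inter> G) \<le> card (V \<inter> span D)" using G(3) Vd(1) by (intro card_mono) auto
      ultimately have G\<G>: "G \<in> \<G> s" using G D(4) by (auto simp: \<G>_def)
      have Gs: "subspace G" "dim G = s" using G(4) by (auto simp: nondegenerate_def)
      obtain Y where Y: "Y \<subseteq> D" "card Y = d - s" "D \<subseteq> span (G \<union> Y)"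
        using ex_spanning_extension[OF Gs(1) G(3) D(3,2)] Gs(2) by blast
      have "span (G \<union> Y) \<subseteq> span D" using G(3) Y(1) by (intro span_minimal) (auto simp: span_base)
      then have "card (V \<inter> span (G \<union> Y)) \<le> card (V \<inter> span D)" using Vd(1) by (intro card_mono) auto
      also have "real (card (V \<inter> span D)) \<le> real (card (V \<inter> G)) / \<gamma>" using \<gamma>G \<gamma> by (simp add: le_divide_eq mult.commute)
      finally have "Y \<in> \<Y> s G" using Y D(1) by (auto simp: \<Y>_def)
      moreover have "D - Y \<in> \<Z> s G Y"
      proof -
        have "finite D" using D(1) Vd(1) finite_subset by blast
        then have "card (D - Y) = Suc s" using Y(1,2) D(2,3) G(2) by (simp add: card_Diff_subset finite_subset)
        then show ?thesis using D(1) Y(3) by (auto simp: \<Z>_def)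
      qed
      moreover have "D = Y \<union> (D - Y)" using Y(1) by blast
      moreover have "s \<in> {1..d}" using G(1,2) D(3) by simp
      ultimately show "D \<in> (\<Union>s\<in>{1..d}. \<Union>G\<in>\<G> s. \<Union>Y\<in>\<Y> s G. (\<union>) Y ` \<Z> s G Y)" using G\<G> by blast
    qed
    then have "card \<D> \<le> card (\<Union>s\<in>{1..d}. \<Union>G\<in>\<G> s. \<Union>Y\<in>\<Y> s G. (\<union>) Y ` \<Z> s G Y)"
      using fin\<G> fin\<Y> fin\<Z> by (intro card_mono finite_UN_I) auto
    also have "\<dots> \<le> (\<Sum>s\<in>{1..d}. card (\<Union>G\<in>\<G> s. \<Union>Y\<in>\<Y> s G. (\<union>) Y ` \<Z> s G Y))"
      by (rule card_UN_le) simp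
    also have "real \<dots> \<le> (\<Sum>s\<in>{1..d}. A s * n ^ d * ln (real l))"
      unfolding of_nat_sum
    proof (rule sum_mono)
      fix s assume s: "s \<in> {1..d}"
      \<comment> \<open>At most \<open>n ^ (d - s)\<close> choices of \<open>Y\<close>, each with at
        most \<open>(card (V \<inter> G) / \<gamma>) ^ Suc s\<close> choices of the rest. The
        exponent \<open>Suc s\<close> is the one in the power-sum bound over
        \<open>\<G> s\<close>.\<close>
      have per_G: "real (card (\<Union>Y\<in>\<Y> s G. (\<union>) Y ` \<Z> s G Y)) \<le> n ^ (d - s) * (real (card (V \<inter> G)) / \<gamma>) ^ Suc s" for G
      proof -
        have "card (\<Union>Y\<in>\<Y> s G. (\<union>) Y ` \<Z> s G Y) \<le> (\<Sum>Y\<in>\<Y> s G. card ((\<union>) Y ` \<Z> s G Y))"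
          by (rule card_UN_le[OF fin\<Y>])
        also have "real \<dots> \<le> (\<Sum>Y\<in>\<Y> s G. (real (card (V \<inter> G)) / \<gamma>) ^ Suc s)"
          unfolding of_nat_sum
        proof (rule sum_mono)
          fix Y assume Y: "Y \<in> \<Y> s G"
          have "card ((\<union>) Y ` \<Z> s G Y) \<le> card (\<Z> s G Y)" by (rule card_image_le[OF fin\<Z>])
          also have "\<dots> \<le> card (V \<inter> span (G \<union> Y)) ^ Suc s"
            unfolding \<Z>_def using Vd(1) by (intro card_subsets_le_power) auto
          also have "real \<dots> \<le> (real (card (V \<inter> G)) / \<gamma>) ^ Suc s"
            unfolding of_nat_power using Y by (intro power_mono) (auto simp: \<Y>_def)
          finally show "real (card ((\<union>) Y ` \<Z> s G Y)) \<le> (real (card (V \<inter> G)) / \<gamma>) ^ Suc s" by simp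
        qed
        also have "\<dots> = real (card (\<Y> s G)) * (real (card (V \<inter> G)) / \<gamma>) ^ Suc s" by simp
        also have "\<dots> \<le> n ^ (d - s) * (real (card (V \<inter> G)) / \<gamma>) ^ Suc s"
        proof (intro mult_right_mono)
          have "card (\<Y> s G) \<le> card {Y. Y \<subseteq> V \<and> card Y = d - s}"
            using Vd(1) by (intro card_mono) (auto simp: \<Y>_def)
          also have "\<dots> \<le> card V ^ (d - s)" by (rule card_subsets_le_power[OF Vd(1)])
          finally show "real (card (\<Y> s G)) \<le> n ^ (d - s)" unfolding n_def by (metis of_nat_le_iff of_nat_power)
        qed (use \<gamma> in auto)
        finally show ?thesis by simp
      qed
      have "card (\<Union>G\<in>\<G> s. \<Union>Y\<in>\<Y> s G. (\<union>) Y ` \<Z> s G Y) \<le> (\<Sum>G\<in>\<G> s. card (\<Union>Y\<in>\<Y> s G. (\<union>) Y ` \<Z> s G Y))"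
        using fin\<G> s by (intro card_UN_le) auto
      also have "real \<dots> \<le> (\<Sum>G\<in>\<G> s. n ^ (d - s) * (real (card (V \<inter> G)) / \<gamma>) ^ Suc s)"
        unfolding of_nat_sum by (intro sum_mono per_G)
      also have "\<dots> = n ^ (d - s) * (1 / \<gamma>) ^ Suc s * (\<Sum>G\<in>\<G> s. real (card (V \<inter> G)) ^ Suc s)"
        unfolding sum_distrib_left by (intro sum.cong refl) (simp add: power_divide)
      also have "\<dots> \<le> n ^ (d - s) * (1 / \<gamma>) ^ Suc s * (real (Suc s) * K s * (3 + 2 * C ^ 2) * n ^ s * ln (real l))"
        unfolding \<G>_def n_def using \<delta>K[of s] s V l \<gamma> by (intro mult_left_mono sum_nondegenerate_powers) auto
      also have "\<dots> = A s * (n ^ (d - s) * n ^ s) * ln (real l)" unfolding A_def by (simp only: mult_ac)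
      also have "n ^ (d - s) * n ^ s = n ^ d" using s by (simp flip: power_add)
      finally show "real (card (\<Union>G\<in>\<G> s. \<Union>Y\<in>\<Y> s G. (\<union>) Y ` \<Z> s G Y)) \<le> A s * n ^ d * ln (real l)" by simp
    qed
    also have "\<dots> = (\<Sum>s\<in>{1..d}. A s) * n ^ d * ln (real l)" by (simp add: sum_distrib_right)
    also have "\<dots> \<le> (1 + (\<Sum>s=1..d. A s)) * n ^ d * ln (real l)"
      using ln_ge_half[OF l(1)] by (intro mult_right_mono) (auto simp: n_def)
    finally show "real (card {D. D \<subseteq> V \<and> card D = d + 1 \<and> dim D \<le> d \<and> card (V \<inter> span D) \<le> l})
        \<le> (1 + (\<Sum>s=1..d. A s)) * real (card V) ^ d * ln (real l)" by (simp add: \<D>_def n_def)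
  qed
qed

section \<open>Random subsets without cohyperplanar points\<close>

text \<open>The left side is the expected size of a sample minus the expected number of members of
  \<open>\<D>\<close> inside it. Some sample attains at least this average, and removing one point
  per bad set destroys them all.\<close>

lemma ex_large_independent_subset:
  fixes p :: real and P :: "'b set"
  assumes P: "finite P" and \<D>: "finite \<D>" "\<And>D. D \<in> \<D> \<Longrightarrow> D \<subseteq> P \<and> card D = Suc d" and p: "0 \<le> p" "p \<le> 1"
  shows "\<exists>S\<subseteq>P. p * real (card P) - p ^ Suc d * real (card \<D>) \<le> real (card S) \<and> (\<forall>D\<in>\<D>. \<not> D \<subseteq> S)"
proof -
  let ?e = "p * real (card P) - p ^ Suc d * real (card \<D>)"
  let ?bad = "\<lambda>A. {D \<in> \<D>. D \<subseteq> A}"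
  let ?f = "\<lambda>A. real (card A) - real (card (?bad A))"
  define m where "m = Max (?f ` Pow P)"
  have "(\<Sum>A\<in>Pow P. subset_weight p P A * real (card (?bad A))) = p ^ Suc d * real (card \<D>)"
    using expected_card[OF P \<D>(1), of "\<lambda>D. D" p] \<D>(2) by simp
  then have "?e = (\<Sum>A\<in>Pow P. subset_weight p P A * ?f A)"
    using expected_card_self[OF P, of p] by (simp add: right_diff_distrib sum_subtractf)
  also have "\<dots> \<le> (\<Sum>A\<in>Pow P. subset_weight p P A * m)"
    unfolding m_def using P by (intro sum_mono mult_left_mono subset_weight_nonneg p Max_ge) auto
  also have "\<dots> = (\<Sum>A\<in>Pow P. subset_weight p P A) * m" by (rule sum_distrib_right[symmetric])
  also have "\<dots> = m" by (simp only: sum_subset_weight[OF P] mult_1)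
  finally have "?e \<le> m" .
  moreover have "m \<in> ?f ` Pow P" unfolding m_def using P by (intro Max_in) auto
  ultimately obtain A where A: "A \<subseteq> P" "?e \<le> ?f A" by auto
  define x where "x = (\<lambda>D::'b set. SOME y. y \<in> D)"
  have x: "x D \<in> D" if "D \<in> \<D>" for D
    unfolding x_def using \<D>(2)[OF that] by (metis card.empty ex_in_conv nat.distinct(1) someI)
  let ?S = "A - x ` ?bad A"
  have "card A \<le> card ?S + card (x ` ?bad A)"
    using diff_card_le_card_Diff[of "x ` ?bad A" A] \<D>(1) by simp
  moreover have "card (x ` ?bad A) \<le> card (?bad A)" using \<D>(1) by (intro card_image_le) auto
  ultimately have "?e \<le> real (card ?S)" using A(2) by linarith
  moreover have "\<not> D \<subseteq> ?S" if "D \<in> \<D>" for D using x[OF that] that by blast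
  ultimately show ?thesis using A(1) by (intro exI[of _ ?S]) auto
qed

text \<open>Two proportional vectors whose first coordinates are both 1 are equal.\<close>

lemma projective_set_lift:
  fixes P :: "'a::real_vector set"
  assumes "finite P"
  shows "projective_set (Pair (1::real) ` P)"
  unfolding projective_set_def using assms by (auto simp: span_singleton zero_prod_def)

text \<open>The family enters only through the point counts: a set on some \<open>h\<close> lifts to
  a dependent set whose span lies in the lift of \<open>h\<close> and therefore contains at most
  \<open>l\<close> points. The constant thus does not depend on the family.\<close>

lemma cohyperplanar_sets_bound:
  fixes C :: real
  shows "\<exists>K\<ge>1. \<forall>(\<H> :: (real ^ 'd) set set) (P :: (real ^ 'd) set) l.
    (\<forall>h\<in>\<H>. hyperplane h) \<longrightarrow> finite P \<longrightarrow> 2 \<le> l \<longrightarrow> real l \<le> C * sqrt (real (card P)) \<longrightarrow>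
    (\<forall>h\<in>\<H>. card (P \<inter> h) \<le> l) \<longrightarrow>
    real (card {D. D \<subseteq> P \<and> card D = CARD('d) + 1 \<and> (\<exists>h\<in>\<H>. D \<subseteq> h)}) \<le> K * real (card P) ^ CARD('d) * ln (real l)"
proof -
  let ?d = "CARD('d)"
  let ?\<phi> = "Pair 1 :: real ^ 'd \<Rightarrow> real \<times> (real ^ 'd)"
  obtain K where K: "K \<ge> 1"
    and bound: "\<And>(V :: (real \<times> (real ^ 'd)) set) l. projective_set V \<Longrightarrow> 2 \<le> l \<Longrightarrow> real l \<le> C * sqrt (real (card V)) \<Longrightarrow>
      real (card {D. D \<subseteq> V \<and> card D = ?d + 1 \<and> dim D \<le> ?d \<and> card (V \<inter> span D) \<le> l}) \<le> K * real (card V) ^ ?d * ln (real l)"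
    using dependent_sets_bound[where 'a = "real \<times> (real ^ 'd)" and C = C and d = ?d] by blast
  show ?thesis
  proof (intro exI[of _ K] conjI allI impI)
    fix \<H> :: "(real ^ 'd) set set" and P :: "(real ^ 'd) set" and l :: nat
    assume \<H>: "\<forall>h\<in>\<H>. hyperplane h" and P: "finite P" and l: "2 \<le> l" "real l \<le> C * sqrt (real (card P))"
      and cohyp: "\<forall>h\<in>\<H>. card (P \<inter> h) \<le> l"
    let ?V = "?\<phi> ` P"
    have V: "card ?V = card P" "finite ?V" using P by (simp_all add: card_image inj_on_def)
    let ?\<D> = "{D. D \<subseteq> P \<and> card D = ?d + 1 \<and> (\<exists>h\<in>\<H>. D \<subseteq> h)}"
    let ?\<D>' = "{D. D \<subseteq> ?V \<and> card D = ?d + 1 \<and> dim D \<le> ?d \<and> card (?V \<inter> span D) \<le> l}"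
    have "(`) ?\<phi> ` ?\<D> \<subseteq> ?\<D>'"
    proof clarify
      fix D h assume D: "D \<subseteq> P" "card D = ?d + 1" "h \<in> \<H>" "D \<subseteq> h"
      obtain a b where ab: "a \<noteq> 0" "h = {x. a \<bullet> x = b}" using \<H> D(3) unfolding hyperplane_def by blast
      \<comment> \<open>The equation \<open>a \<bullet> x = b\<close> made homogeneous in
        \<open>(1, x)\<close>.\<close>
      let ?h = "{v. (- b, a) \<bullet> v = 0}"
      have "?\<phi> ` D \<subseteq> ?h" using D(4) by (auto simp: ab(2))
      then have sub: "span (?\<phi> ` D) \<subseteq> ?h" by (rule span_minimal) (rule subspace_hyperplane)
      have "dim (span (?\<phi> ` D)) \<le> dim ?h" using sub by (rule dim_subset)
      also have "dim ?h = ?d" using ab(1) by (subst dim_hyperplane) (auto simp: zero_prod_def)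
      finally have "dim (?\<phi> ` D) \<le> ?d" by simp
      moreover have "card (?V \<inter> span (?\<phi> ` D)) \<le> l"
      proof -
        have "?V \<inter> span (?\<phi> ` D) \<subseteq> ?\<phi> ` (P \<inter> h)" using sub by (auto simp: ab(2))
        then have "card (?V \<inter> span (?\<phi> ` D)) \<le> card (P \<inter> h)"
          using P by (meson card_image_le card_mono finite_Int finite_imageI le_trans)
        then show ?thesis using cohyp D(3) by (meson le_trans)
      qed
      moreover have "card (?\<phi> ` D) = ?d + 1" using D(2) by (simp add: card_image inj_on_def)
      ultimately show "?\<phi> ` D \<subseteq> ?V \<and> card (?\<phi> ` D) = ?d + 1 \<and> dim (?\<phi> ` D) \<le> ?d \<and> card (?V \<inter> span (?\<phi> ` D)) \<le> l"
        using D(1) by auto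
    qed
    moreover have "inj_on ((`) ?\<phi>) ?\<D>" by (rule inj_onI) (simp add: inj_image_eq_iff inj_on_def)
    moreover have "finite ?\<D>'" by (rule finite_subset[of _ "Pow ?V"]) (use V in auto)
    ultimately have "card ?\<D> \<le> card ?\<D>'" by (intro card_inj_on_le)
    also have "real (card ?\<D>') \<le> K * real (card P) ^ ?d * ln (real l)"
      using bound[OF projective_set_lift[OF P] l(1)] l(2) V(1) by simp
    finally show "real (card ?\<D>) \<le> K * real (card P) ^ ?d * ln (real l)" by simp
  qed (fact K)
qed

theorem theorem19:
  fixes C :: real
  assumes "CARD('d::finite) \<ge> 2" and "C > 0"
  shows "\<exists>c::real. c > 0 \<and>
    (\<forall>(\<H> :: (real ^ 'd) set set) (P :: (real ^ 'd) set) (n::nat) (l::nat).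
      (\<forall>h\<in>\<H>. hyperplane h) \<longrightarrow>
      finite P \<longrightarrow> card P = n \<longrightarrow>
      2 \<le> l \<longrightarrow> real l \<le> C * sqrt (real n) \<longrightarrow>
      (\<forall>h\<in>\<H>. card (P \<inter> h) \<le> l) \<longrightarrow>
      (\<exists>S. S \<subseteq> P \<and>
        real (card S) \<ge> c * (real n / ln (real l)) powr (1 / real CARD('d)) \<and>
        (\<forall>h\<in>\<H>. card (S \<inter> h) \<le> CARD('d))))"
proof -
  let ?d = "CARD('d)"
  obtain K where K: "K \<ge> 1"
    and bound: "\<And>(\<H> :: (real ^ 'd) set set) (P :: (real ^ 'd) set) l.
    (\<forall>h\<in>\<H>. hyperplane h) \<Longrightarrow> finite P \<Longrightarrow> 2 \<le> l \<Longrightarrow> real l \<le> C * sqrt (real (card P)) \<Longrightarrow>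
    (\<forall>h\<in>\<H>. card (P \<inter> h) \<le> l) \<Longrightarrow>
    real (card {D. D \<subseteq> P \<and> card D = ?d + 1 \<and> (\<exists>h\<in>\<H>. D \<subseteq> h)}) \<le> K * real (card P) ^ ?d * ln (real l)"
    using cohyperplanar_sets_bound[where 'd = 'd and C = C] by blast
  define c where "c = 1 / 2 * (1 / (2 * K)) powr (1 / real ?d)"
  show ?thesis
  proof (intro exI[of _ c] conjI allI impI)
    show "c > 0" using K by (simp add: c_def)
    fix \<H> :: "(real ^ 'd) set set" and P :: "(real ^ 'd) set" and n l :: nat
    assume \<H>: "\<forall>h\<in>\<H>. hyperplane h" and P: "finite P" and n: "card P = n"
      and l: "2 \<le> l" "real l \<le> C * sqrt (real n)" and cohyp: "\<forall>h\<in>\<H>. card (P \<inter> h) \<le> l"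
    define \<D> where "\<D> = {D. D \<subseteq> P \<and> card D = ?d + 1 \<and> (\<exists>h\<in>\<H>. D \<subseteq> h)}"
    have fin\<D>: "finite \<D>" by (rule finite_subset[of _ "Pow P"]) (use P in \<open>auto simp: \<D>_def\<close>)
    have T: "real (card \<D>) \<le> K * real n ^ ?d * ln (real l)"
      unfolding \<D>_def using bound[OF \<H> P l(1) _ cohyp] l(2) n by simp
    \<comment> \<open>For \<open>n = 0\<close> the upper bound on \<open>l\<close> would contradict
      \<open>2 \<le> l\<close>.\<close>
    have n1: "real n \<ge> 1" using l by (cases n) auto
    have ln: "1 \<le> 2 * ln (real l)" using ln_ge_half[OF l(1)] by simp
    \<comment> \<open>\<open>q = p ^ d\<close> solves \<open>q * K * n ^ d * ln l = n / 2\<close>,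
      so deletions cost at most half of the expected sample size \<open>p * n\<close>. The factor
      1/2 and the \<open>2 * K\<close> in \<open>c\<close> come from here.\<close>
    define q where "q = 1 / (2 * K * real n ^ (?d - 1) * ln (real l))"
    define p where "p = q powr (1 / real ?d)"
    have "1 * 1 * 1 \<le> K * real n ^ (?d - 1) * (2 * ln (real l))"
      using K n1 ln by (intro mult_mono one_le_power) auto
    then have q: "0 < q" "q \<le> 1" by (auto simp: q_def field_simps)
    have p: "0 \<le> p" "p \<le> 1" using q by (auto simp: p_def intro: powr_le1)
    have pd: "p ^ ?d = q" using q by (simp add: p_def powr_realpow[symmetric] powr_powr)
    have nd: "real n ^ ?d = real n * real n ^ (?d - 1)" by (simp flip: power_Suc)
    have qK: "q * (K * real n ^ ?d * ln (real l)) = real n / 2"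
      using K n1 ln unfolding q_def nd by (simp add: field_simps)
    obtain S where S: "S \<subseteq> P" "p * real (card P) - p ^ Suc ?d * real (card \<D>) \<le> real (card S)" "\<forall>D\<in>\<D>. \<not> D \<subseteq> S"
      using ex_large_independent_subset[OF P fin\<D> _ p, of ?d] by (auto simp: \<D>_def)
    have "p ^ Suc ?d * real (card \<D>) \<le> p ^ Suc ?d * (K * real n ^ ?d * ln (real l))"
      using T p by (intro mult_left_mono) auto
    also have "\<dots> = p * (q * (K * real n ^ ?d * ln (real l)))" by (simp add: pd mult.assoc)
    also have "\<dots> = p * (real n / 2)" by (simp only: qK)
    finally have "p * real n / 2 \<le> real (card S)" using S(2) n by simp
    also have "p * real n / 2 = c * (real n / ln (real l)) powr (1 / real ?d)"
    proof -
      have "real n = (real n ^ ?d) powr (1 / real ?d)"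
        using n1 by (simp add: powr_realpow[symmetric] powr_powr)
      then have "p * real n = (q * real n ^ ?d) powr (1 / real ?d)"
        using q n1 by (simp add: p_def powr_mult)
      also have "q * real n ^ ?d = 1 / (2 * K) * (real n / ln (real l))"
        using K n1 ln unfolding q_def nd by (simp add: field_simps)
      also have "\<dots> powr (1 / real ?d) = (1 / (2 * K)) powr (1 / real ?d) * (real n / ln (real l)) powr (1 / real ?d)"
        by (rule powr_mult)
      finally show ?thesis by (simp add: c_def)
    qed
    finally have large: "c * (real n / ln (real l)) powr (1 / real ?d) \<le> real (card S)" .
    have "card (S \<inter> h) \<le> ?d" if h: "h \<in> \<H>" for h
    proof (rule ccontr)
      assume "\<not> ?thesis"
      then have "?d + 1 \<le> card (S \<inter> h)" by simp
      \<comment> \<open>Excluding sets of size exactly \<open>d + 1\<close> suffices, since any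
        larger set contains one.\<close>
      then obtain D where D: "D \<subseteq> S \<inter> h" "card D = ?d + 1" by (metis obtain_subset_with_card_n)
      then have "D \<in> \<D>" using S(1) h unfolding \<D>_def by blast
      then show False using S(3) D(1) by blast
    qed
    then show "\<exists>S. S \<subseteq> P \<and> real (card S) \<ge> c * (real n / ln (real l)) powr (1 / real ?d) \<and>
        (\<forall>h\<in>\<H>. card (S \<inter> h) \<le> ?d)"
      using S(1) large by blast
  qed
qed

end
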